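(* Consider a well-posed and topologically detectable networked linear dynamical system with observed nodes $\mathcal V_o$, hidden nodes $\mathcal V_h$, and topology $\mathcal G_{\mathcal T}=(\mathcal V,\mathcal E_{\mathcal T})$, $\mathcal V=\mathcal V_o\cup\mathcal V_h$. Assume: (1) the period of every hidden node's input divides $T=\mathrm{LCM}\{T_1,\dots,T_m\}$, the least common multiple of the periods of the observed nodes; (2) (bidirected) if $\mathsf H_{ji}(z)\ne0$ then $\mathsf H_{ij}(z)\neq0$; (3) the hidden nodes in $\mathcal G_{\mathcal T}$ are at least four or more hops away from each other; (4) $\mathcal G_{\mathcal T}$ is a tree (any two nodes are connected by a unique path), and every hidden node is at least three hops away from all leaf nodes of $\mathcal G_{\mathcal T}$. Let $\mathcal G_{T_o}=(\mathcal V_o,\mathcal E_{T_o})$ be the restriction of $\mathcal G_{\mathcal T}$ to the observed nodes and let $\mathcal G_c=(\mathcal V_o,\mathcal E_c)$ be the undirected graph with $\mathcal E_c=\{(i,j): \boldsymbol B_i'\Phi_{oo}^{-1}\boldsymbol B_j\ne\boldsymbol 0\}$. Suppose $\overline{\mathcal T}_1,\overline{\mathcal T}_2$ are two disconnected (distinct connected) components of $\mathcal G_{T_o}$ with observed nodes $c\in\overline{\mathcal T}_1$ and $e\in\overline{\mathcal T}_2$. If for all $b\in\overline{\mathcal T}_1$ and all $f\in\overline{\mathcal T}_2$ such that $b-c$ and $e-f$ are edges of $\mathcal G_{T_o}$, the nodes $b,c,e,f$ form a clique in $\mathcal G_c$, then there exists $d\in\mathcal V_h$ such that $c-d-e$ is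 a path in $\mathcal G_{\mathcal T}$.
   Context: Setting: scalar complex-valued processes $x_i(k)=\sum_{j\ne i}(h_{ij}*x_j)(k)+e_i(k)$, $i=1,\dots,n$, with mutually uncorrelated wide sense cyclostationary inputs $e_i$ of period $T_i$ (mean and correlation invariant under simultaneous time shift by $T_i$); the processes are jointly cyclostationary with period $T$. Nodes $\mathcal V_o=\{1,\dots,m\}$ are observed and $\mathcal V_h=\{m+1,\dots,n\}$ are hidden. Lifting $X_i(k)=[x_i(kT),\dots,x_i(kT+T-1)]'$, $E_i(k)=[e_i(kT),\dots,e_i(kT+T-1)]'$ gives $T$-dimensional wide-sense stationary processes with $\mathsf X(z)=\mathbb H(z)\mathsf X(z)+\mathsf E(z)$, where $\mathbb H=\begin{bmatrix}\mathsf H_{oo}&\mathsf H_{oh}\\ \mathsf H_{ho}&\mathsf H_{hh}\end{bmatrix}$ has $T\times T$ blocks $\mathsf H_{ij}(z)$ ($\mathsf H_{ii}=\boldsymbol 0$), partitioned by observed/hidden nodes, and $\mathsf H_{ij}\neq\boldsymbol 0$ iff $\mathsf h_{ij}\ne0$ (here $\mathsf h_{ij}$ is the transfer function of $h_{ij}$). The power spectral density $\Phi_E$ is block diagonal. Well-posed and topologically detectable: $\Phi_E^{-1}(\omega)\succ0$ and $\mathbb I-\mathbb H(\omega)$ is invertible for almost every $\omega\in[0,2\pi)$ ($z=e^{\iota\omega}$). The power spectral density $\Phi_X$ satisfies $\Phi_X^{-1}=(\mathbb I-\mathbb H)^*\Phi_E^{-1}(\mathbb I-\mathbb H)$; $\Phi_{oo}$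 is the submatrix of $\Phi_X$ for the observed nodes. $\boldsymbol B_i'A\boldsymbol B_j$ is the $(i,j)$-th $T\times T$ block of $A$; it is $\ne\boldsymbol 0$ if it is not identically zero as a function of $\omega$. The generative graph has edge set $\mathcal E=\{(i,j):\mathbb H(i,j)\ne\boldsymbol 0\}$, and the topology $\mathcal G_{\mathcal T}$ is the undirected graph with $(i,j)\in\mathcal E_{\mathcal T}$ iff $(i,j)\in\mathcal E$ or $(j,i)\in\mathcal E$; $\mathcal E_{T_o}$ consists of the edges of $\mathcal E_{\mathcal T}$ with both endpoints in $\mathcal V_o$. Two nodes are $r$ hops apart if their graph distance in $\mathcal G_{\mathcal T}$ is $r$. Leaf nodes are the nodes of degree $1$ in $\mathcal G_{\mathcal T}$. *)

theory Defs
  imports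
    "HOL-Probability.Probability"
    "Jordan_Normal_Form.Gauss_Jordan_Elimination"
    "Jordan_Normal_Form.Schur_Decomposition"
    "Jordan_Normal_Form.DL_Submatrix"
    "Graph_Theory.Shortest_Path"
    "Graph_Theory.Pair_Digraph"
    "Graph_Theory.Digraph_Component"
begin

section \<open>Second-order processes on the integers\<close>

definition corr :: "'a measure \<Rightarrow> ('a \<Rightarrow> complex) \<Rightarrow> ('a \<Rightarrow> complex) \<Rightarrow> complex" where
  "corr M u v = (\<integral>a. u a * cnj (v a) \<partial>M)"

text \<open>For a singleton index set this is wide-sense cyclostationarity of one process. The number
  \<open>P\<close> is some period of the mean and of the correlation, not necessarily the least one.\<close>

definition jointly_cyclostationary ::
    "'a measure \<Rightarrow> nat \<Rightarrow> nat set \<Rightarrow> (nat \<Rightarrow> int \<Rightarrow> 'a \<Rightarrow> complex) \<Rightarrow> bool" where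
  "jointly_cyclostationary M P I u \<longleftrightarrow>
     0 < P \<and>
     (\<forall>i\<in>I. \<forall>k. u i k \<in> borel_measurable M \<and> integrable M (\<lambda>a. (norm (u i k a))\<^sup>2)) \<and>
     (\<forall>i\<in>I. \<forall>k. (\<integral>a. u i (k + int P) a \<partial>M) = (\<integral>a. u i k a \<partial>M)) \<and>
     (\<forall>i\<in>I. \<forall>j\<in>I. \<forall>k l.
        corr M (u i (k + int P)) (u j (l + int P)) = corr M (u i k) (u j l))"

text \<open>Summability of the correlations makes the power spectral density a convergent Fourier
  series. It also forces periodic means to vanish, so that correlation and covariance agree.\<close>

definition summable_correlations ::
    "'a measure \<Rightarrow> nat set \<Rightarrow> (nat \<Rightarrow> int \<Rightarrow> 'a \<Rightarrow> complex) \<Rightarrow> bool" where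
  "summable_correlations M I u \<longleftrightarrow>
     (\<forall>i\<in>I. \<forall>j\<in>I. \<forall>k. (\<lambda>\<tau>. norm (corr M (u i (k + \<tau>)) (u j k))) summable_on UNIV)"

section \<open>Networked linear dynamical systems\<close>

text \<open>Nodes are \<open>0, \<dots>, n - 1\<close>; \<open>h i j\<close> is the (two-sided) impulse response from node \<open>j\<close> to
  node \<open>i\<close>, \<open>x i\<close> the process at node \<open>i\<close>, \<open>\<epsilon> i\<close> its input and \<open>per i\<close> the period of that
  input. The values \<open>h i i\<close> play no role.\<close>

definition nlds ::
    "'a measure \<Rightarrow> nat \<Rightarrow> (nat \<Rightarrow> nat) \<Rightarrow> (nat \<Rightarrow> nat \<Rightarrow> int \<Rightarrow> complex) \<Rightarrow>
     (nat \<Rightarrow> int \<Rightarrow> 'a \<Rightarrow> complex) \<Rightarrow> (nat \<Rightarrow> int \<Rightarrow> 'a \<Rightarrow> complex) \<Rightarrow> bool" where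
  "nlds M n per h x \<epsilon> \<longleftrightarrow>
     prob_space M \<and>
     (\<forall>i<n. \<forall>j<n. i \<noteq> j \<longrightarrow> (\<lambda>k. norm (h i j k)) summable_on UNIV) \<and>
     (\<forall>i<n. jointly_cyclostationary M (per i) {i} \<epsilon>) \<and>
     (\<forall>i<n. \<forall>j<n. i \<noteq> j \<longrightarrow> (\<forall>k l. corr M (\<epsilon> i k) (\<epsilon> j l) = 0)) \<and>
     summable_correlations M {..<n} \<epsilon> \<and>
     jointly_cyclostationary M (Lcm (per ` {..<n})) {..<n} x \<and>
     summable_correlations M {..<n} x \<and>
     (\<forall>i<n. \<forall>k. AE a in M.
        x i k a = (\<Sum>j\<in>{..<n} - {i}. \<Sum>\<^sub>\<infinity>l. h i j l * x j (k - l) a) + \<epsilon> i k a)"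

section \<open>Lifting and spectra\<close>

definition lift_process :: "nat \<Rightarrow> (int \<Rightarrow> 'a \<Rightarrow> complex) \<Rightarrow> int \<Rightarrow> 'a \<Rightarrow> complex vec" where
  "lift_process T u k a = vec T (\<lambda>s. u (k * int T + int s) a)"

definition assemble :: "nat \<Rightarrow> nat \<Rightarrow> (nat \<Rightarrow> nat \<Rightarrow> complex mat) \<Rightarrow> complex mat" where
  "assemble n T F = mat (n * T) (n * T) (\<lambda>(a, b). F (a div T) (b div T) $$ (a mod T, b mod T))"

definition block :: "nat \<Rightarrow> complex mat \<Rightarrow> nat \<Rightarrow> nat \<Rightarrow> complex mat" where
  "block T A i j = mat T T (\<lambda>(s, t). A $$ (i * T + s, j * T + t))"

text \<open>Substituting \<open>l = \<kappa> T + s - t\<close> in \<open>(h * x)(k T + s) = (\<Sum>l. h l * x (k T + s - l))\<close> turns the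
  scalar convolution into a convolution of the lifted process with the \<open>T \<times> T\<close> kernel
  \<open>\<kappa> \<mapsto> (h (\<kappa> T + s - t))\<close>; its transfer function is evaluated at \<open>z = cis \<omega>\<close>.\<close>

definition lifted_transfer :: "nat \<Rightarrow> (int \<Rightarrow> complex) \<Rightarrow> real \<Rightarrow> complex mat" where
  "lifted_transfer T g \<omega> = mat T T (\<lambda>(s, t).
     \<Sum>\<^sub>\<infinity>\<kappa>. g (\<kappa> * int T + int s - int t) * cis (- \<omega> * real_of_int \<kappa>))"

definition transfer_matrix ::
    "nat \<Rightarrow> nat \<Rightarrow> (nat \<Rightarrow> nat \<Rightarrow> int \<Rightarrow> complex) \<Rightarrow> real \<Rightarrow> complex mat" where
  "transfer_matrix n T h \<omega> =
     assemble n T (\<lambda>i j. if i = j then 0\<^sub>m T T else lifted_transfer T (h i j) \<omega>)"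

text \<open>The lifted processes are wide-sense stationary when \<open>T\<close> is a period, so the correlation at
  lag \<open>\<kappa>\<close> may be taken between times \<open>\<kappa>\<close> and \<open>0\<close>.\<close>

definition cross_psd ::
    "'a measure \<Rightarrow> nat \<Rightarrow> (int \<Rightarrow> 'a \<Rightarrow> complex) \<Rightarrow> (int \<Rightarrow> 'a \<Rightarrow> complex) \<Rightarrow> real \<Rightarrow> complex mat" where
  "cross_psd M T u v \<omega> = mat T T (\<lambda>(s, t).
     \<Sum>\<^sub>\<infinity>\<kappa>. corr M (\<lambda>a. lift_process T u \<kappa> a $ s) (\<lambda>a. lift_process T v 0 a $ t)
            * cis (- \<omega> * real_of_int \<kappa>))"

definition psd ::
    "'a measure \<Rightarrow> nat \<Rightarrow> nat \<Rightarrow> (nat \<Rightarrow> int \<Rightarrow> 'a \<Rightarrow> complex) \<Rightarrow> real \<Rightarrow> complex mat" where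
  "psd M n T u \<omega> = assemble n T (\<lambda>i j. cross_psd M T (u i) (u j) \<omega>)"

definition observed_psd ::
    "'a measure \<Rightarrow> nat \<Rightarrow> nat \<Rightarrow> nat \<Rightarrow> (nat \<Rightarrow> int \<Rightarrow> 'a \<Rightarrow> complex) \<Rightarrow> real \<Rightarrow> complex mat" where
  "observed_psd M n m T u \<omega> = submatrix (psd M n T u \<omega>) {..<m * T} {..<m * T}"

text \<open>Unspecified on singular matrices; spectra are only inverted almost everywhere.\<close>

abbreviation inv_mat :: "complex mat \<Rightarrow> complex mat" where
  "inv_mat A \<equiv> the (mat_inverse A)"

text \<open>The strict order on complex numbers entails that both sides have the same imaginary part.\<close>

definition positive_definite :: "complex mat \<Rightarrow> bool" where
  "positive_definite A \<longleftrightarrow> square_mat A \<and> mat_adjoint A = A \<and>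
     (\<forall>v\<in>carrier_vec (dim_row A). v \<noteq> 0\<^sub>v (dim_row A) \<longrightarrow> 0 < (A *\<^sub>v v) \<bullet>c v)"

definition well_posed_detectable ::
    "'a measure \<Rightarrow> nat \<Rightarrow> nat \<Rightarrow> (nat \<Rightarrow> nat \<Rightarrow> int \<Rightarrow> complex) \<Rightarrow>
     (nat \<Rightarrow> int \<Rightarrow> 'a \<Rightarrow> complex) \<Rightarrow> bool" where
  "well_posed_detectable M n T h \<epsilon> \<longleftrightarrow>
     (AE \<omega>\<in>{0..<2 * pi} in lborel.
        invertible_mat (psd M n T \<epsilon> \<omega>) \<and>
        positive_definite (inv_mat (psd M n T \<epsilon> \<omega>)) \<and>
        invertible_mat (1\<^sub>m (n * T) - transfer_matrix n T h \<omega>))"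

text \<open>Inverse spectra are defined up to null sets only, hence ``not identically zero'' means not
  almost everywhere zero. For \<open>transfer_matrix\<close>, which is continuous for summable impulse
  responses, this is the same as being nonzero at some frequency.\<close>

definition nonzero_block :: "nat \<Rightarrow> (real \<Rightarrow> complex mat) \<Rightarrow> nat \<Rightarrow> nat \<Rightarrow> bool" where
  "nonzero_block T A i j \<longleftrightarrow> \<not> (AE \<omega>\<in>{0..<2 * pi} in lborel. block T (A \<omega>) i j = 0\<^sub>m T T)"

section \<open>Graphs\<close>

text \<open>An undirected graph is represented by the digraph having both orientations of every edge.
  Its strongly connected components are then the connected components, out-degree is degree, and
  \<^term>\<open>pre_digraph.apath\<close> is the notion of (vertex-simple) path.\<close>

definition generative_edges ::
    "nat \<Rightarrow> nat \<Rightarrow> (nat \<Rightarrow> nat \<Rightarrow> int \<Rightarrow> complex) \<Rightarrow> (nat \<times> nat) set" where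
  "generative_edges n T h =
     {(i, j). i < n \<and> j < n \<and> nonzero_block T (transfer_matrix n T h) i j}"

definition network_topology ::
    "nat \<Rightarrow> nat \<Rightarrow> (nat \<Rightarrow> nat \<Rightarrow> int \<Rightarrow> complex) \<Rightarrow> (nat, nat \<times> nat) pre_digraph" where
  "network_topology n T h = with_proj \<lparr> pverts = {..<n},
     parcs = {(i, j). (i, j) \<in> generative_edges n T h \<or> (j, i) \<in> generative_edges n T h} \<rparr>"

definition inverse_psd_graph ::
    "'a measure \<Rightarrow> nat \<Rightarrow> nat \<Rightarrow> nat \<Rightarrow> (nat \<Rightarrow> int \<Rightarrow> 'a \<Rightarrow> complex) \<Rightarrow>
     (nat, nat \<times> nat) pre_digraph" where
  "inverse_psd_graph M n m T x = with_proj \<lparr> pverts = {..<m},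
     parcs = {(i, j). i < m \<and> j < m \<and>
       nonzero_block T (\<lambda>\<omega>. inv_mat (observed_psd M n m T x \<omega>)) i j} \<rparr>"

abbreviation hop_distance :: "('v, 'e) pre_digraph \<Rightarrow> 'v \<Rightarrow> 'v \<Rightarrow> ereal" where
  "hop_distance G u v \<equiv> wf_digraph.\<mu> G (\<lambda>_. 1) u v"

definition leaf :: "('v, 'e) pre_digraph \<Rightarrow> 'v \<Rightarrow> bool" where
  "leaf G v \<longleftrightarrow> v \<in> verts G \<and> out_degree G v = 1"

text \<open>The predicate \<^term>\<open>tree\<close> of the graph library is not suitable here: it counts an edge
  together with its reversal as a cycle.\<close>

definition undirected_tree :: "('v, 'e) pre_digraph \<Rightarrow> bool" where
  "undirected_tree G \<longleftrightarrow> (\<forall>u\<in>verts G. \<forall>v\<in>verts G. \<exists>!p. pre_digraph.apath G u p v)"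

definition clique :: "('v, 'e) pre_digraph \<Rightarrow> 'v set \<Rightarrow> bool" where
  "clique G S \<longleftrightarrow> S \<subseteq> verts G \<and> (\<forall>u\<in>S. \<forall>v\<in>S. u \<noteq> v \<longrightarrow> u \<rightarrow>\<^bsub>G\<^esub> v)"

end

theory Submission
  imports Defs
begin

text \<open>Write \<open>G = I - H\<close>. The relation \<open>G x = \<epsilon>\<close> between the lifted processes turns into
  \<open>\<Phi>\<^sub>E = G \<Phi>\<^sub>X G\<^sup>*\<close> at every frequency (\<open>psd_factorization\<close>). At almost every frequency all the matrices
  involved are invertible, and \<open>K = G\<^sup>* \<Phi>\<^sub>E\<^sup>-\<^sup>1 G\<close> is the inverse of \<open>\<Phi>\<^sub>X\<close>. It inherits definiteness
  from \<open>\<Phi>\<^sub>E\<^sup>-\<^sup>1\<close>, and because \<open>\<Phi>\<^sub>E\<close> is block diagonal, its block \<open>(i, j)\<close> vanishes unless some node is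
  equal or adjacent to both \<open>i\<close> and \<open>j\<close>, that is, unless \<open>i\<close> and \<open>j\<close> are at most two hops apart.

  Distinct hidden nodes are four or more hops apart, so the hidden part \<open>K\<^sub>h\<^sub>h\<close> is block diagonal, and the
  Schur complement \<open>\<Phi>\<^sub>o\<^sub>o\<^sup>-\<^sup>1 = K\<^sub>o\<^sub>o - K\<^sub>o\<^sub>h K\<^sub>h\<^sub>h\<^sup>-\<^sup>1 K\<^sub>h\<^sub>o\<close> has a nonzero block \<open>(i, j)\<close> only if \<open>i\<close> and \<open>j\<close> are
  within two hops of each other or both within two hops of one hidden node
  (\<open>leading_submatrix_inverse_sparse\<close>, \<open>inverse_psd_graph_edge\<close>). Either way the two ends of an
  edge of \<open>\<G>\<^sub>c\<close> are at distance at most four in the tree.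

  The rest is combinatorics of the tree (\<open>common_hidden_neighbour\<close>). As \<open>c\<close> and \<open>e\<close> lie in different
  components of the observed subgraph, the path from \<open>c\<close> to \<open>e\<close> passes through a hidden node \<open>d\<close>.
  Suppose it is not \<open>c - d - e\<close>. An end of the path that is within two hops of \<open>d\<close> is not a leaf, so the
  path can be prolonged there by one vertex, and the new end is observed because it is within three
  hops of \<open>d\<close>. After this the two ends are at distance at least two from \<open>d\<close>, one of them at distance
  at least three, so they are at least five hops apart. But one of them is \<open>c\<close> or an observed
  neighbour \<open>b\<close> of \<open>c\<close>, and the other is \<open>e\<close> or an observed neighbour \<open>f\<close> of \<open>e\<close>; the clique condition
  makes them adjacent in \<open>\<G>\<^sub>c\<close>, hence at most four hops apart, a contradiction.\<close>

section \<open>Convolutions and their sampled Fourier series\<close>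

lemma summable_on_finite_Times:
  fixes f :: "'i \<Rightarrow> 'j \<Rightarrow> complex"
  assumes "finite I" "\<And>i. i \<in> I \<Longrightarrow> f i summable_on J"
  shows "(\<lambda>(i, j). f i j) summable_on I \<times> J"
  unfolding summable_on_iff_abs_summable_on_complex Infinite_Sum.abs_summable_on_Sigma_iff
  using assms by (auto simp: summable_on_iff_abs_summable_on_complex)

lemma has_sum_finite_sum:
  fixes f :: "'i \<Rightarrow> 'j \<Rightarrow> complex"
  assumes "\<And>i. i \<in> I \<Longrightarrow> (f i has_sum s i) J"
  shows "((\<lambda>j. \<Sum>i\<in>I. f i j) has_sum (\<Sum>i\<in>I. s i)) J"
  using assms by (induction I rule: infinite_finite_induct) (auto intro: has_sum_add)

lemma summable_on_inj_comp:
  fixes f :: "'j \<Rightarrow> complex"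
  assumes "f summable_on UNIV" "inj g"
  shows "(\<lambda>i. f (g i)) summable_on UNIV"
proof -
  have "f summable_on range g"
    using assms(1) summable_on_subset_banach by blast
  thus ?thesis
    using summable_on_reindex[OF assms(2), of f] by (simp add: o_def)
qed

lemma summable_on_times_bounded:
  fixes f b :: "'j \<Rightarrow> complex"
  assumes "f summable_on A" "\<And>j. j \<in> A \<Longrightarrow> norm (b j) \<le> B"
  shows "(\<lambda>j. f j * b j) summable_on A"
  unfolding summable_on_iff_abs_summable_on_complex
proof (rule Infinite_Sum.abs_summable_on_comparison_test'[where g = "\<lambda>j. norm (f j) * B"])
  show "(\<lambda>j. norm (f j) * B) summable_on A"
    using assms(1) by (auto simp: summable_on_iff_abs_summable_on_complex intro: summable_on_cmult_left)
qed (auto simp: norm_mult intro!: mult_left_mono assms(2))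

text \<open>The double family \<open>a \<alpha> * b \<beta>\<close> is absolutely summable. Summed along the antidiagonals
  \<open>\<alpha> + \<beta> = \<kappa>\<close>, it gives the Cauchy product over the integers.\<close>

lemma convolution:
  fixes a b :: "int \<Rightarrow> complex"
  assumes a: "a summable_on UNIV" and b: "b summable_on UNIV"
  shows convolution_has_sum:
      "((\<lambda>\<kappa>. \<Sum>\<^sub>\<infinity>\<alpha>. a \<alpha> * b (\<kappa> - \<alpha>)) has_sum infsum a UNIV * infsum b UNIV) UNIV"
    and convolution_summable: "(\<lambda>\<alpha>. a \<alpha> * b (\<kappa> - \<alpha>)) summable_on UNIV"
proof -
  have a': "(\<lambda>x. norm (a x)) summable_on UNIV" and b': "(\<lambda>x. norm (b x)) summable_on UNIV"
    using a b by (simp_all add: summable_on_iff_abs_summable_on_complex)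
  have "(\<lambda>p. norm (a (fst p) * b (snd p))) summable_on UNIV \<times> UNIV"
    unfolding Infinite_Sum.abs_summable_on_Sigma_iff
  proof (intro conjI ballI)
    show "(\<lambda>y. norm (a (fst (x, y)) * b (snd (x, y)))) summable_on UNIV" for x
      using summable_on_cmult_right[OF b', of "norm (a x)"] by (simp add: norm_mult)
    have "norm (\<Sum>\<^sub>\<infinity>y. norm (a (fst (x, y)) * b (snd (x, y)))) =
        norm (a x) * (\<Sum>\<^sub>\<infinity>y. norm (b y))" for x
    proof -
      have "0 \<le> (\<Sum>\<^sub>\<infinity>y. norm (b y))" by (rule infsum_nonneg) simp
      thus ?thesis
        unfolding norm_mult fst_conv snd_conv infsum_cmult_right' by simp
    qed
    thus "(\<lambda>x. norm (\<Sum>\<^sub>\<infinity>y. norm (a (fst (x, y)) * b (snd (x, y))))) summable_on UNIV"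
      using summable_on_cmult_left[OF a'] by simp
  qed
  hence prod: "(\<lambda>(\<alpha>, \<beta>). a \<alpha> * b \<beta>) summable_on UNIV \<times> UNIV"
    by (simp only: summable_on_iff_abs_summable_on_complex case_prod_unfold)
  have val: "infsum (\<lambda>(\<alpha>, \<beta>). a \<alpha> * b \<beta>) (UNIV \<times> UNIV) = infsum a UNIV * infsum b UNIV"
    by (subst infsum_Sigma'_banach[OF prod, symmetric])
      (simp add: infsum_cmult_right' infsum_cmult_left')
  have hs: "((\<lambda>(\<alpha>, \<beta>). a \<alpha> * b \<beta>) has_sum infsum a UNIV * infsum b UNIV) (UNIV \<times> UNIV)"
    using prod val by (metis has_sum_infsum)
  have hs': "((\<lambda>(\<kappa>, \<alpha>). a \<alpha> * b (\<kappa> - \<alpha>)) has_sum infsum a UNIV * infsum b UNIV) (UNIV \<times> UNIV)"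
    by (rule iffD1[OF has_sum_reindex_bij_witness hs,
          of "\<lambda>(\<kappa>, \<alpha>). (\<alpha>, \<kappa> - \<alpha>)" "\<lambda>(\<alpha>, \<beta>). (\<alpha> + \<beta>, \<alpha>)"]) auto
  have sm: "(\<lambda>(\<kappa>, \<alpha>). a \<alpha> * b (\<kappa> - \<alpha>)) summable_on UNIV \<times> UNIV"
    using hs' has_sum_imp_summable by blast
  show "(\<lambda>\<alpha>. a \<alpha> * b (\<kappa> - \<alpha>)) summable_on UNIV"
    using summable_on_SigmaD1[OF sm, of \<kappa>] by simp
  show "((\<lambda>\<kappa>. \<Sum>\<^sub>\<infinity>\<alpha>. a \<alpha> * b (\<kappa> - \<alpha>)) has_sum infsum a UNIV * infsum b UNIV) UNIV"
    using has_sum_infsum[OF summable_on_Sigma_banach[OF sm]]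
    unfolding infsum_Sigma'_banach[OF sm] infsumI[OF hs'] .
qed

text \<open>The Fourier series at \<open>\<omega>\<close> of the subsequence of \<open>f\<close> along the residue class \<open>r\<close> modulo \<open>T\<close>.
  The entries of the lifted transfer matrices and of the lifted spectra are all of this form.\<close>

definition phase_sum :: "nat \<Rightarrow> real \<Rightarrow> (int \<Rightarrow> complex) \<Rightarrow> int \<Rightarrow> complex" where
  "phase_sum T \<omega> f r = (\<Sum>\<^sub>\<infinity>\<kappa>. f (\<kappa> * int T + r) * cis (- \<omega> * real_of_int \<kappa>))"

lemma phase_summable:
  assumes "f summable_on UNIV" "0 < T"
  shows "(\<lambda>\<kappa>. f (\<kappa> * int T + r) * cis (- \<omega> * real_of_int \<kappa>)) summable_on UNIV"
proof (rule summable_on_times_bounded[where B = 1])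
  have "inj (\<lambda>\<kappa>. \<kappa> * int T + r)" using assms(2) by (intro injI) simp
  from summable_on_inj_comp[OF assms(1) this]
  show "(\<lambda>\<kappa>. f (\<kappa> * int T + r)) summable_on UNIV" .
qed simp

text \<open>Lifting turns scalar convolution into a matrix product: the lags \<open>l\<close> are written uniquely as
  \<open>\<alpha> T + s - u\<close> with \<open>u < T\<close>, and for each residue \<open>u\<close> what remains is an ordinary convolution in \<open>\<alpha>\<close>,
  whose Fourier series factors.\<close>

lemma phase_sum_convolution:
  fixes g R :: "int \<Rightarrow> complex"
  assumes T: "0 < T" and g: "g summable_on UNIV" and R: "R summable_on UNIV"
  shows "phase_sum T \<omega> (\<lambda>k. \<Sum>\<^sub>\<infinity>l. g l * R (k - l)) s =
    (\<Sum>u<T. phase_sum T \<omega> g (s - int u) * phase_sum T \<omega> R (int u))"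
proof -
  define a where "a u \<alpha> = g (\<alpha> * int T + (s - int u)) * cis (- \<omega> * real_of_int \<alpha>)" for u \<alpha>
  define b where "b u \<kappa> = R (\<kappa> * int T + int u) * cis (- \<omega> * real_of_int \<kappa>)" for u \<kappa>
  have sa: "a u summable_on UNIV" and sb: "b u summable_on UNIV" for u
    unfolding a_def b_def using phase_summable T g R by auto
  have step: "(\<Sum>\<^sub>\<infinity>l. g l * R (\<kappa> * int T + s - l)) * cis (- \<omega> * real_of_int \<kappa>) =
      (\<Sum>u<T. \<Sum>\<^sub>\<infinity>\<alpha>. a u \<alpha> * b u (\<kappa> - \<alpha>))" for \<kappa>
  proof -
    let ?f = "\<lambda>l. g l * R (\<kappa> * int T + s - l)"
    let ?h = "\<lambda>(u, \<alpha>). ?f (\<alpha> * int T + (s - int u))"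
    have sf: "?f summable_on UNIV"
      using convolution_summable[OF g R] .
    have bij: "bij_betw (\<lambda>(u, \<alpha>). \<alpha> * int T + (s - int u)) ({..<T} \<times> UNIV) UNIV"
    proof (rule bij_betw_byWitness[where f' = "\<lambda>l. (nat ((s - l) mod int T), - ((s - l) div int T))"])
      show "\<forall>p\<in>{..<T} \<times> UNIV. (\<lambda>l. (nat ((s - l) mod int T), - ((s - l) div int T)))
          (case p of (u, \<alpha>) \<Rightarrow> \<alpha> * int T + (s - int u)) = p"
      proof
        fix p :: "nat \<times> int" assume "p \<in> {..<T} \<times> UNIV"
        then obtain u \<alpha> where p: "p = (u, \<alpha>)" and "u < T" by auto
        have e: "s - (\<alpha> * int T + (s - int u)) = int u + (- \<alpha>) * int T" by simp
        show "(nat ((s - (case p of (u, \<alpha>) \<Rightarrow> \<alpha> * int T + (s - int u))) mod int T),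
            - ((s - (case p of (u, \<alpha>) \<Rightarrow> \<alpha> * int T + (s - int u))) div int T)) = p"
          unfolding p prod.case e using \<open>u < T\<close> by (simp only: mod_mult_self1 div_mult_self1) simp
      qed
      show "\<forall>l\<in>UNIV. (case (nat ((s - l) mod int T), - ((s - l) div int T)) of
          (u, \<alpha>) \<Rightarrow> \<alpha> * int T + (s - int u)) = l"
      proof
        fix l
        have "0 \<le> (s - l) mod int T" using T by simp
        moreover have "(s - l) mod int T + (s - l) div int T * int T = s - l"
          by (rule mod_div_mult_eq)
        moreover have "- q * int T + (s - int (nat r)) = l"
          if "0 \<le> r" "r + q * int T = s - l" for q r
          using that by simp
        ultimately show "(case (nat ((s - l) mod int T), - ((s - l) div int T)) of
          (u, \<alpha>) \<Rightarrow> \<alpha> * int T + (s - int u)) = l"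
          unfolding prod.case by blast
      qed
      show "(\<lambda>l. (nat ((s - l) mod int T), - ((s - l) div int T))) ` UNIV \<subseteq> {..<T} \<times> UNIV"
        using T by (auto simp: nat_less_iff)
    qed auto
    have sh: "?h summable_on {..<T} \<times> UNIV"
      using summable_on_reindex_bij_betw[OF bij, of ?f] sf by (simp add: case_prod_unfold)
    have "infsum ?f UNIV = infsum ?h ({..<T} \<times> UNIV)"
      using infsum_reindex_bij_betw[OF bij, of ?f] by (simp add: case_prod_unfold)
    also have "\<dots> = (\<Sum>u<T. \<Sum>\<^sub>\<infinity>\<alpha>. ?f (\<alpha> * int T + (s - int u)))"
      by (subst infsum_Sigma'_banach[OF sh, symmetric]) simp
    finally have "infsum ?f UNIV * cis (- \<omega> * real_of_int \<kappa>) =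
       (\<Sum>u<T. \<Sum>\<^sub>\<infinity>\<alpha>. ?f (\<alpha> * int T + (s - int u)) * cis (- \<omega> * real_of_int \<kappa>))"
      by (simp add: sum_distrib_right infsum_cmult_left' flip: infsum_cmult_left')
    also have "\<dots> = (\<Sum>u<T. \<Sum>\<^sub>\<infinity>\<alpha>. a u \<alpha> * b u (\<kappa> - \<alpha>))"
      unfolding a_def b_def
      by (intro sum.cong infsum_cong refl) (simp add: algebra_simps cis_mult)
    finally show ?thesis .
  qed
  have "phase_sum T \<omega> (\<lambda>k. \<Sum>\<^sub>\<infinity>l. g l * R (k - l)) s = (\<Sum>\<^sub>\<infinity>\<kappa>. \<Sum>u<T. \<Sum>\<^sub>\<infinity>\<alpha>. a u \<alpha> * b u (\<kappa> - \<alpha>))"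
    unfolding phase_sum_def step ..
  also have "\<dots> = (\<Sum>u<T. infsum (a u) UNIV * infsum (b u) UNIV)"
    by (intro infsumI has_sum_finite_sum convolution_has_sum sa sb)
  finally show ?thesis
    unfolding a_def b_def phase_sum_def .
qed

text \<open>Joint periodicity moves a shift of the second argument by a multiple of \<open>T\<close> into the first, so
  summability in the first argument carries over on each of the finitely many residue classes.\<close>

lemma summable_on_second_argument:
  fixes F :: "int \<Rightarrow> int \<Rightarrow> complex"
  assumes T: "0 < T" and shift: "\<And>k l \<kappa>. F (k + \<kappa> * int T) (l + \<kappa> * int T) = F k l"
    and F: "\<And>l. (\<lambda>k. F k l) summable_on UNIV"
  shows "(\<lambda>l. F k l) summable_on UNIV"
proof -
  have bij: "bij_betw (\<lambda>(u, \<kappa>). int u + \<kappa> * int T) ({..<T} \<times> UNIV) UNIV"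
    by (rule bij_betw_byWitness[where f' = "\<lambda>l. (nat (l mod int T), l div int T)"])
       (use T in \<open>auto simp: nat_less_iff\<close>)
  have "(\<lambda>(u, \<kappa>). F k (int u + \<kappa> * int T)) summable_on {..<T} \<times> UNIV"
  proof (rule summable_on_finite_Times)
    fix u
    have "F k (int u + \<kappa> * int T) = F (k - \<kappa> * int T) (int u)" for \<kappa>
      using shift[of "k - \<kappa> * int T" \<kappa> "int u"] by simp
    moreover have "inj (\<lambda>\<kappa>. k - \<kappa> * int T)" using T by (intro injI) simp
    ultimately show "(\<lambda>\<kappa>. F k (int u + \<kappa> * int T)) summable_on UNIV"
      using summable_on_inj_comp[OF F[of "int u"]] by simp
  qed simp
  thus ?thesis
    using summable_on_reindex_bij_betw[OF bij, of "F k"] by (simp add: case_prod_unfold)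
qed

section \<open>Correlations of filtered processes\<close>

lemma borel_measurable_cnj [measurable (raw)]:
  "f \<in> borel_measurable M \<Longrightarrow> (\<lambda>a. cnj (f a)) \<in> borel_measurable M"
  by (rule borel_measurable_continuous_on[of cnj]) (simp add: continuous_on_cnj)

lemma
  fixes u v :: "'a \<Rightarrow> complex"
  assumes [measurable]: "u \<in> borel_measurable M" "v \<in> borel_measurable M"
    and u: "integrable M (\<lambda>a. (norm (u a))\<^sup>2)" and v: "integrable M (\<lambda>a. (norm (v a))\<^sup>2)"
  shows integrable_mult_cnj: "integrable M (\<lambda>a. u a * cnj (v a))"
    and integral_norm_mult_cnj:
      "(\<integral>a. norm (u a * cnj (v a)) \<partial>M) \<le> (\<integral>a. (norm (u a))\<^sup>2 \<partial>M) + (\<integral>a. (norm (v a))\<^sup>2 \<partial>M)"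
proof -
  have bound: "norm (u a * cnj (v a)) \<le> (norm (u a))\<^sup>2 + (norm (v a))\<^sup>2" for a
  proof -
    have "0 \<le> (norm (u a) - norm (v a))\<^sup>2" by simp
    moreover have "0 \<le> norm (u a) * norm (v a)" by simp
    ultimately show ?thesis
      unfolding norm_mult complex_mod_cnj power2_diff by linarith
  qed
  have sum: "integrable M (\<lambda>a. (norm (u a))\<^sup>2 + (norm (v a))\<^sup>2)"
    using u v by simp
  show int: "integrable M (\<lambda>a. u a * cnj (v a))"
  proof (rule Bochner_Integration.integrable_bound[OF sum])
    show "AE a in M. norm (u a * cnj (v a)) \<le> norm ((norm (u a))\<^sup>2 + (norm (v a))\<^sup>2)"
      using bound by (intro AE_I2) (metis abs_of_nonneg norm_ge_zero order_trans real_norm_def)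
  qed measurable
  show "(\<integral>a. norm (u a * cnj (v a)) \<partial>M) \<le> (\<integral>a. (norm (u a))\<^sup>2 \<partial>M) + (\<integral>a. (norm (v a))\<^sup>2 \<partial>M)"
    by (subst Bochner_Integration.integral_add[OF u v, symmetric])
      (intro integral_mono bound integrable_norm int sum)
qed

lemma AE_summable_if_summable_integrals:
  fixes f :: "nat \<Rightarrow> 'a \<Rightarrow> complex"
  assumes f: "\<And>i. integrable M (f i)" and s: "summable (\<lambda>i. \<integral>a. norm (f i a) \<partial>M)"
  shows "AE a in M. summable (\<lambda>i. norm (f i a))"
proof -
  have [measurable]: "f i \<in> borel_measurable M" for i using f by auto
  have "(\<integral>\<^sup>+a. (\<Sum>i. ennreal (norm (f i a))) \<partial>M) = (\<Sum>i. \<integral>\<^sup>+a. ennreal (norm (f i a)) \<partial>M)"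
    by (intro nn_integral_suminf) auto
  also have "\<dots> = (\<Sum>i. ennreal (\<integral>a. norm (f i a) \<partial>M))"
    by (intro arg_cong[where f = suminf] ext nn_integral_eq_integral integrable_norm f) auto
  also have "\<dots> \<noteq> \<infinity>"
    using s by (simp add: ennreal_suminf_neq_top integral_nonneg_AE)
  finally have "AE a in M. (\<Sum>i. ennreal (norm (f i a))) \<noteq> \<infinity>"
    by (intro nn_integral_PInf_AE) auto
  thus ?thesis
    by eventually_elim (auto intro: summable_suminf_not_top)
qed

text \<open>Correlation commutes with an absolutely summable filter applied to processes of bounded second
  moment, by dominated convergence. The filtered process is an infinite sum taken pointwise, whose
  measurability is not evident; the integrable \<open>S\<close>, equal to the product almost everywhere,
  stands in for it.\<close>

lemma corr_filtered:
  fixes h :: "int \<Rightarrow> complex" and X :: "int \<Rightarrow> 'a \<Rightarrow> complex"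
  assumes X[measurable]: "\<And>l. X l \<in> borel_measurable M"
    and X2: "\<And>l. integrable M (\<lambda>a. (norm (X l a))\<^sup>2)"
    and C: "\<And>l. (\<integral>a. (norm (X l a))\<^sup>2 \<partial>M) \<le> C"
    and z[measurable]: "z \<in> borel_measurable M" and z2: "integrable M (\<lambda>a. (norm (z a))\<^sup>2)"
    and h: "h summable_on UNIV"
  obtains S where "integrable M S" "AE a in M. (\<Sum>\<^sub>\<infinity>l. h l * X l a) * cnj (z a) = S a"
    "(\<integral>a. S a \<partial>M) = (\<Sum>\<^sub>\<infinity>l. h l * corr M (X l) z)"
proof -
  define f where "f l a = h l * X l a * cnj (z a)" for l a
  define F where "F m = f (int_decode m)" for m
  define B where "B = C + (\<integral>a. (norm (z a))\<^sup>2 \<partial>M)"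
  have int: "integrable M (f l)" for l
    using integrable_mult_cnj[OF X z X2 z2, of l] unfolding f_def by (simp add: mult.assoc)
  have F: "integrable M (F m)" for m unfolding F_def by (rule int)
  have le: "(\<integral>a. norm (f l a) \<partial>M) \<le> norm (h l) * B" for l
  proof -
    have "(\<integral>a. norm (f l a) \<partial>M) = norm (h l) * (\<integral>a. norm (X l a * cnj (z a)) \<partial>M)"
      unfolding f_def by (simp add: norm_mult mult.assoc)
    also have "\<dots> \<le> norm (h l) * B"
      using integral_norm_mult_cnj[OF X z X2 z2, of l] C[of l]
      unfolding B_def by (intro mult_left_mono) auto
    finally show ?thesis .
  qed
  have bij: "bij_betw int_decode UNIV UNIV" by (rule bij_int_decode)
  have "(\<lambda>m. norm (h (int_decode m))) summable_on UNIV"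
    using h summable_on_reindex_bij_betw[OF bij, of "\<lambda>l. norm (h l)"]
    by (simp add: summable_on_iff_abs_summable_on_complex)
  hence "summable (\<lambda>m. norm (h (int_decode m)) * B)"
    by (intro summable_mult2 summable_on_imp_summable)
  hence sums: "summable (\<lambda>m. \<integral>a. norm (F m a) \<partial>M)"
  proof (rule summable_comparison_test')
    fix m :: nat
    have "0 \<le> (\<integral>a. norm (F m a) \<partial>M)" by (intro integral_nonneg_AE) simp
    thus "norm (\<integral>a. norm (F m a) \<partial>M) \<le> norm (h (int_decode m)) * B"
      unfolding real_norm_def F_def using le[of "int_decode m"] by linarith
  qed
  note AE = AE_summable_if_summable_integrals[OF F sums]
  have nat_int: "infsum (\<lambda>l. w l) UNIV = (\<Sum>m. w (int_decode m))"
    if "summable (\<lambda>m. norm (w (int_decode m)))" for w :: "int \<Rightarrow> complex"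
  proof -
    have "((\<lambda>m. w (int_decode m)) has_sum (\<Sum>m. w (int_decode m))) UNIV"
      by (rule norm_summable_imp_has_sum[OF that summable_sums[OF summable_norm_cancel[OF that]]])
    from infsumI[OF this] show ?thesis
      using infsum_reindex_bij_betw[OF bij, of w] by simp
  qed
  have "AE a in M. (\<Sum>\<^sub>\<infinity>l. h l * X l a) * cnj (z a) = (\<Sum>m. F m a)"
    using AE
  proof eventually_elim
    case (elim a)
    have "(\<Sum>\<^sub>\<infinity>l. h l * X l a) * cnj (z a) = (\<Sum>\<^sub>\<infinity>l. f l a)"
      unfolding f_def by (simp add: infsum_cmult_left')
    also have "\<dots> = (\<Sum>m. F m a)"
      unfolding F_def by (rule nat_int) (use elim in \<open>simp add: F_def\<close>)
    finally show ?case .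
  qed
  moreover have "integrable M (\<lambda>a. \<Sum>m. F m a)"
    by (rule integrable_suminf[OF F AE sums])
  moreover have "(\<integral>a. (\<Sum>m. F m a) \<partial>M) = (\<Sum>\<^sub>\<infinity>l. h l * corr M (X l) z)"
  proof -
    have "(\<integral>a. (\<Sum>m. F m a) \<partial>M) = (\<Sum>m. \<integral>a. F m a \<partial>M)"
      by (rule integral_suminf[OF F AE sums])
    also have "\<dots> = (\<Sum>\<^sub>\<infinity>l. \<integral>a. f l a \<partial>M)"
      unfolding F_def
    proof (rule nat_int[symmetric])
      show "summable (\<lambda>m. norm (\<integral>a. f (int_decode m) a \<partial>M))"
        by (rule summable_comparison_test'[OF sums]) (simp add: F_def integral_norm_bound)
    qed
    also have "\<dots> = (\<Sum>\<^sub>\<infinity>l. h l * corr M (X l) z)"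
      unfolding f_def corr_def by (simp add: mult.assoc)
    finally show ?thesis .
  qed
  ultimately show thesis using that by blast
qed

lemma shift_by_multiple:
  fixes F :: "int \<Rightarrow> int \<Rightarrow> 'b"
  assumes "\<And>k l. F (k + P) (l + P) = F k l"
  shows "F (k + \<kappa> * P) (l + \<kappa> * P) = F k l"
proof (induction \<kappa> rule: int_induct[where k = 0])
  case (step1 i)
  thus ?case using assms[of "k + i * P" "l + i * P"] by (simp add: algebra_simps)
next
  case (step2 i)
  thus ?case using assms[of "k + (i - 1) * P" "l + (i - 1) * P"] by (simp add: algebra_simps)
qed simp

text \<open>The second moments are periodic in time, so they take finitely many values.\<close>

lemma cyclostationary_second_moment_bounded:
  assumes "jointly_cyclostationary M P I u" "finite I"
  obtains C where "\<And>i k. i \<in> I \<Longrightarrow> (\<integral>a. (norm (u i k a))\<^sup>2 \<partial>M) \<le> C"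
proof -
  define m where "m i k = (\<integral>a. (norm (u i k a))\<^sup>2 \<partial>M)" for i k
  have P: "0 < P" using assms by (simp add: jointly_cyclostationary_def)
  have m: "complex_of_real (m i k) = corr M (u i k) (u i k)" for i k
    unfolding m_def corr_def by (simp only: complex_norm_square flip: integral_complex_of_real)
  have nonneg: "0 \<le> m i k" for i k unfolding m_def by simp
  show thesis
  proof (rule that)
    fix i k assume i: "i \<in> I"
    have "corr M (u i (k mod int P + k div int P * int P)) (u i (k mod int P + k div int P * int P))
        = corr M (u i (k mod int P)) (u i (k mod int P))"
      by (rule shift_by_multiple[where F = "\<lambda>k l. corr M (u i k) (u i l)"])
        (use assms i in \<open>simp add: jointly_cyclostationary_def\<close>)
    hence "complex_of_real (m i k) = complex_of_real (m i (k mod int P))" by (simp add: m)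
    hence "m i k = m i (k mod int P)" by (simp only: of_real_eq_iff)
    also have "\<dots> \<le> (\<Sum>r<P. m i (int r))"
      using member_le_sum[of "nat (k mod int P)" "{..<P}" "\<lambda>r. m i (int r)"] nonneg P
      by (simp add: nat_less_iff)
    also have "\<dots> \<le> (\<Sum>i\<in>I. \<Sum>r<P. m i (int r))"
      using member_le_sum[of i I "\<lambda>i. \<Sum>r<P. m i (int r)"] nonneg i assms(2)
      by (simp add: sum_nonneg)
    finally show "(\<integral>a. (norm (u i k a))\<^sup>2 \<partial>M) \<le> (\<Sum>i\<in>I. \<Sum>r<P. m i (int r))"
      by (simp add: m_def)
  qed
qed

text \<open>The impulse response of \<open>I - H\<close>, which maps the processes to their inputs.\<close>

definition whitening_kernel :: "(nat \<Rightarrow> nat \<Rightarrow> int \<Rightarrow> complex) \<Rightarrow> nat \<Rightarrow> nat \<Rightarrow> int \<Rightarrow> complex" where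
  "whitening_kernel h i j l = (if i = j then if l = 0 then 1 else 0 else - h i j l)"

lemma infsum_delta_mult: "(\<Sum>\<^sub>\<infinity>l. (if l = (0::int) then 1 else 0) * f l) = (f 0 :: complex)"
proof -
  have "(\<Sum>\<^sub>\<infinity>l. (if l = (0::int) then 1 else 0) * f l) = (\<Sum>\<^sub>\<infinity>l\<in>{0}. f l)"
    by (rule infsum_cong_neutral) auto
  thus ?thesis by simp
qed

lemma corr_input:
  assumes sys: "nlds M n per h x \<epsilon>" and i: "i < n"
    and z: "z \<in> borel_measurable M" and z2: "integrable M (\<lambda>a. (norm (z a))\<^sup>2)"
  shows "corr M (\<epsilon> i k) z =
    (\<Sum>p<n. \<Sum>\<^sub>\<infinity>l. whitening_kernel h i p l * corr M (x p (k - l)) z)"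
proof -
  note [measurable] = z
  have x[measurable]: "x p l \<in> borel_measurable M" and x2: "integrable M (\<lambda>a. (norm (x p l a))\<^sup>2)"
    if "p < n" for p l
    using sys that by (auto simp: nlds_def jointly_cyclostationary_def)
  have eps[measurable]: "\<epsilon> i l \<in> borel_measurable M" for l
    using sys i by (auto simp: nlds_def jointly_cyclostationary_def)
  obtain C where C: "\<And>p l. p \<in> {..<n} \<Longrightarrow> (\<integral>a. (norm (x p l a))\<^sup>2 \<partial>M) \<le> C"
    using cyclostationary_second_moment_bounded[of M _ "{..<n}" x] sys
    by (auto simp: nlds_def)
  have "\<forall>j\<in>{..<n} - {i}. \<exists>S. integrable M S \<and>
      (AE a in M. (\<Sum>\<^sub>\<infinity>l. h i j l * x j (k - l) a) * cnj (z a) = S a) \<and>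
      (\<integral>a. S a \<partial>M) = (\<Sum>\<^sub>\<infinity>l. h i j l * corr M (x j (k - l)) z)"
  proof
    fix j assume "j \<in> {..<n} - {i}"
    hence j: "j < n" "j \<in> {..<n}" "i \<noteq> j" by auto
    have "h i j summable_on UNIV"
      using sys i j unfolding nlds_def summable_on_iff_abs_summable_on_complex by blast
    from corr_filtered[of "\<lambda>l. x j (k - l)" M C z "h i j", OF x[OF j(1)] x2[OF j(1)] C[OF j(2)] z z2 this]
    show "\<exists>S. integrable M S \<and>
      (AE a in M. (\<Sum>\<^sub>\<infinity>l. h i j l * x j (k - l) a) * cnj (z a) = S a) \<and>
      (\<integral>a. S a \<partial>M) = (\<Sum>\<^sub>\<infinity>l. h i j l * corr M (x j (k - l)) z)"
      by blast
  qed
  from bchoice[OF this] obtain S where S: "\<And>j. j \<in> {..<n} - {i} \<Longrightarrow> integrable M (S j)"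
      "\<And>j. j \<in> {..<n} - {i} \<Longrightarrow>
        AE a in M. (\<Sum>\<^sub>\<infinity>l. h i j l * x j (k - l) a) * cnj (z a) = S j a"
      "\<And>j. j \<in> {..<n} - {i} \<Longrightarrow>
        (\<integral>a. S j a \<partial>M) = (\<Sum>\<^sub>\<infinity>l. h i j l * corr M (x j (k - l)) z)"
    by blast
  have intx: "integrable M (\<lambda>a. x i k a * cnj (z a))"
    by (rule integrable_mult_cnj[OF x[OF i] z x2[OF i] z2])
  have intS: "integrable M (\<lambda>a. \<Sum>j\<in>{..<n} - {i}. S j a)"
    using S(1) by (intro Bochner_Integration.integrable_sum) auto
  have eq: "AE a in M. x i k a = (\<Sum>j\<in>{..<n} - {i}. \<Sum>\<^sub>\<infinity>l. h i j l * x j (k - l) a) + \<epsilon> i k a"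
    using sys i by (simp add: nlds_def)
  have allS: "AE a in M. \<forall>j\<in>{..<n} - {i}.
      (\<Sum>\<^sub>\<infinity>l. h i j l * x j (k - l) a) * cnj (z a) = S j a"
    using S(2) by (intro AE_finite_allI) auto
  have "AE a in M. \<epsilon> i k a * cnj (z a) = x i k a * cnj (z a) - (\<Sum>j\<in>{..<n} - {i}. S j a)"
    using eq allS
  proof eventually_elim
    case (elim a)
    have "(\<Sum>j\<in>{..<n} - {i}. S j a) = 
        (\<Sum>j\<in>{..<n} - {i}. \<Sum>\<^sub>\<infinity>l. h i j l * x j (k - l) a) * cnj (z a)"
      unfolding sum_distrib_right using elim(2) by (intro sum.cong) auto
    thus ?case using elim(1) by (simp add: algebra_simps)
  qed
  hence "corr M (\<epsilon> i k) z = (\<integral>a. x i k a * cnj (z a) - (\<Sum>j\<in>{..<n} - {i}. S j a) \<partial>M)"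
    unfolding corr_def using intx intS
    by (intro integral_cong_AE) (auto intro!: borel_measurable_times borel_measurable_diff simp: borel_measurable_integrable)
  also have "\<dots> = corr M (x i k) z - (\<Sum>j\<in>{..<n} - {i}. \<integral>a. S j a \<partial>M)"
    unfolding corr_def using intx intS S(1)
    by (subst Bochner_Integration.integral_diff) (auto simp: Bochner_Integration.integral_sum)
  also have "\<dots> = corr M (x i k) z +
      (\<Sum>j\<in>{..<n} - {i}. \<Sum>\<^sub>\<infinity>l. - h i j l * corr M (x j (k - l)) z)"
    using S(3) by (simp add: infsum_uminus sum_negf)
  also have "\<dots> = (\<Sum>p<n. \<Sum>\<^sub>\<infinity>l. whitening_kernel h i p l * corr M (x p (k - l)) z)"
    using i by (subst sum.remove[of "{..<n}" i])
      (auto simp: whitening_kernel_def infsum_delta_mult cong: if_cong intro!: sum.cong)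
  finally show ?thesis .
qed

section \<open>Inverses of sparse complex matrices\<close>

lemma mat_adjoint_dim: "A \<in> carrier_mat nr nc \<Longrightarrow> mat_adjoint A \<in> carrier_mat nc nr"
  by (auto simp: mat_adjoint_def)

lemma mat_adjoint_index:
  assumes "(A :: complex mat) \<in> carrier_mat nr nc" "i < nc" "j < nr"
  shows "mat_adjoint A $$ (i, j) = cnj (A $$ (j, i))"
  using assms by (auto simp: mat_adjoint_def mat_of_rows_index)

lemma index_mult_mat_sum:
  assumes "A \<in> carrier_mat nr N" "B \<in> carrier_mat N nc" "i < nr" "j < nc"
  shows "(A * B) $$ (i, j) = (\<Sum>k<N. A $$ (i, k) * B $$ (k, j))"
  using assms by (auto simp: scalar_prod_def atLeast0LessThan intro!: sum.cong)

lemma index_mult_mat_vec_sum: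
  assumes "A \<in> carrier_mat nr N" "v \<in> carrier_vec N" "i < nr"
  shows "(A *\<^sub>v v) $ i = (\<Sum>k<N. A $$ (i, k) * v $ k)"
  using assms by (auto simp: scalar_prod_def atLeast0LessThan intro!: sum.cong)

lemma mat_adjoint_mult:
  assumes A: "(A :: complex mat) \<in> carrier_mat nr N" and B: "B \<in> carrier_mat N nc"
  shows "mat_adjoint (A * B) = mat_adjoint B * mat_adjoint A"
proof (rule eq_matI)
  note adj = mat_adjoint_dim[OF A] mat_adjoint_dim[OF B] mat_adjoint_dim[OF mult_carrier_mat[OF A B]]
  fix i j assume "i < dim_row (mat_adjoint B * mat_adjoint A)" "j < dim_col (mat_adjoint B * mat_adjoint A)"
  hence ij: "i < nc" "j < nr" using adj by auto
  have "mat_adjoint (A * B) $$ (i, j) = cnj (\<Sum>k<N. A $$ (j, k) * B $$ (k, i))"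
    using ij by (subst mat_adjoint_index[OF mult_carrier_mat[OF A B]])
      (simp_all add: index_mult_mat_sum[OF A B])
  also have "\<dots> = (\<Sum>k<N. mat_adjoint B $$ (i, k) * mat_adjoint A $$ (k, j))"
    using ij by (auto simp: mat_adjoint_index[OF A] mat_adjoint_index[OF B] intro!: sum.cong)
  also have "\<dots> = (mat_adjoint B * mat_adjoint A) $$ (i, j)"
    using ij by (subst index_mult_mat_sum[OF adj(2,1)]) auto
  finally show "mat_adjoint (A * B) $$ (i, j) = (mat_adjoint B * mat_adjoint A) $$ (i, j)" .
qed (use A B in \<open>auto simp: mat_adjoint_def\<close>)

lemma cscalar_prod_mat_adjoint:
  assumes A: "(A :: complex mat) \<in> carrier_mat N N" and v: "v \<in> carrier_vec N" "w \<in> carrier_vec N"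
  shows "(mat_adjoint A *\<^sub>v w) \<bullet>c v = w \<bullet>c (A *\<^sub>v v)"
proof -
  have "(mat_adjoint A *\<^sub>v w) \<bullet>c v = (\<Sum>i<N. (\<Sum>j<N. cnj (A $$ (j, i)) * w $ j) * cnj (v $ i))"
    using A v index_mult_mat_vec_sum[OF mat_adjoint_dim[OF A], of w]
    by (auto simp: scalar_prod_def atLeast0LessThan mat_adjoint_index[OF A] intro!: sum.cong)
  also have "\<dots> = (\<Sum>i<N. \<Sum>j<N. w $ j * cnj (A $$ (j, i) * v $ i))"
    unfolding sum_distrib_right complex_cnj_mult by (intro sum.cong refl) (simp only: mult_ac)
  also have "\<dots> = (\<Sum>j<N. \<Sum>i<N. w $ j * cnj (A $$ (j, i) * v $ i))"
    by (rule sum.swap)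
  also have "\<dots> = w \<bullet>c (A *\<^sub>v v)"
    using A v index_mult_mat_vec_sum[OF A, of v]
    by (auto simp: scalar_prod_def atLeast0LessThan sum_distrib_left intro!: sum.cong)
  finally show ?thesis .
qed

lemma inv_mat_of_injective:
  assumes A: "(A :: complex mat) \<in> carrier_mat N N" and inj: "\<And>v. v \<in> carrier_vec N \<Longrightarrow> A *\<^sub>v v = 0\<^sub>v N \<Longrightarrow> v = 0\<^sub>v N"
  shows "A * inv_mat A = 1\<^sub>m N" "inv_mat A * A = 1\<^sub>m N" "inv_mat A \<in> carrier_mat N N"
proof -
  have "Determinant.det A \<noteq> 0"
    using det_0_iff_vec_prod_zero_field[OF A] inj by blast
  hence "mat_inverse A \<noteq> None"
    using det_non_zero_imp_unit[OF A, where b = "()"] mat_inverse(1)[OF A, where b = "()"] by blast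
  then obtain X where X: "mat_inverse A = Some X" by blast
  show "A * inv_mat A = 1\<^sub>m N" "inv_mat A * A = 1\<^sub>m N" "inv_mat A \<in> carrier_mat N N"
    using mat_inverse(2)[OF A X] X by auto
qed

text \<open>Positive definiteness without the sign: enough to make every principal submatrix injective.\<close>

definition anisotropic :: "complex mat \<Rightarrow> bool" where
  "anisotropic A \<longleftrightarrow> (\<forall>v\<in>carrier_vec (dim_row A). (A *\<^sub>v v) \<bullet>c v = 0 \<longrightarrow> v = 0\<^sub>v (dim_row A))"

text \<open>If \<open>A v\<close> vanishes wherever \<open>v\<close> does not, then \<open>A v\<close> is orthogonal to \<open>v\<close>. This one observation
  replaces the invertibility of all principal submatrices of \<open>A\<close>.\<close>

lemma anisotropic_complementary_zero:
  assumes A: "A \<in> carrier_mat N N" "anisotropic A" and v: "v \<in> carrier_vec N"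
    and z: "\<And>i. i < N \<Longrightarrow> v $ i = 0 \<or> (A *\<^sub>v v) $ i = 0"
  shows "v = 0\<^sub>v N"
proof -
  have "(A *\<^sub>v v) \<bullet>c v = (\<Sum>i<N. (A *\<^sub>v v) $ i * cnj (v $ i))"
    using A v by (auto simp: scalar_prod_def atLeast0LessThan intro!: sum.cong)
  also have "\<dots> = 0" using z by (intro sum.neutral) auto
  finally show ?thesis using A v by (auto simp: anisotropic_def)
qed

text \<open>A matrix is block diagonal with respect to the labels exactly when it commutes with the
  coordinate projections \<open>P\<close> onto the label classes, and this property passes to the inverse.\<close>

lemma inverse_of_label_diagonal:
  assumes A: "(A :: complex mat) \<in> carrier_mat N N" and X: "X \<in> carrier_mat N N"
    and inv: "A * X = 1\<^sub>m N" "X * A = 1\<^sub>m N"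
    and diag: "\<And>i j. i < N \<Longrightarrow> j < N \<Longrightarrow> lab i \<noteq> lab j \<Longrightarrow> A $$ (i, j) = 0"
    and ij: "i < N" "j < N" "lab i \<noteq> lab j"
  shows "X $$ (i, j) = 0"
proof -
  define P where "P = mat_diag N (\<lambda>a. if lab a = lab i then 1 else 0 :: complex)"
  have P: "P \<in> carrier_mat N N" by (simp add: P_def)
  have comm: "P * A = A * P"
    unfolding P_def mat_diag_mult_left[OF A] mat_diag_mult_right[OF A]
    by (rule eq_matI) (auto simp: diag)
  have "P * X = (X * A) * (P * X)" using inv P X by simp
  also have "\<dots> = X * (A * P) * X"
    using A P X by (simp add: assoc_mult_mat[of _ N N _ N _ N])
  also have "\<dots> = X * P * (A * X)"
    unfolding comm[symmetric] using A P X by (simp add: assoc_mult_mat[of _ N N _ N _ N])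
  also have "\<dots> = X * P" using inv P X by simp
  finally have "(P * X) $$ (i, j) = (X * P) $$ (i, j)" by simp
  thus ?thesis
    using ij unfolding P_def mat_diag_mult_left[OF X] mat_diag_mult_right[OF X] by simp
qed

lemma pick_lessThan: "i < m \<Longrightarrow> pick {..<m} i = i"
proof (induction i)
  case 0
  thus ?case unfolding pick.simps by (intro Least_equality) auto
next
  case (Suc i)
  hence "pick {..<m} i = i" by simp
  show ?case
    unfolding pick.simps \<open>pick {..<m} i = i\<close> using Suc.prems by (intro Least_equality) auto
qed

lemma leading_submatrix:
  assumes "A \<in> carrier_mat N N" "m \<le> N"
  shows "submatrix A {..<m} {..<m} \<in> carrier_mat m m"
    and "\<And>i j. i < m \<Longrightarrow> j < m \<Longrightarrow> submatrix A {..<m} {..<m} $$ (i, j) = A $$ (i, j)"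
proof -
  have "{i. i < N \<and> i \<in> {..<m}} = {..<m}" using assms by auto
  hence card: "card {i. i < N \<and> i \<in> {..<m}} = m" by (simp only: card_lessThan)
  show "submatrix A {..<m} {..<m} \<in> carrier_mat m m"
    by (intro carrier_matI) (simp_all only: dim_submatrix carrier_matD[OF assms(1)] card)
  show "submatrix A {..<m} {..<m} $$ (i, j) = A $$ (i, j)" if "i < m" "j < m" for i j
    by (subst submatrix_index)
      (simp_all only: carrier_matD[OF assms(1)] card that pick_lessThan)
qed

lemma sum_vanishing_above:
  fixes f :: "nat \<Rightarrow> complex"
  assumes "m \<le> N" "\<And>k. m \<le> k \<Longrightarrow> k < N \<Longrightarrow> f k = 0"
  shows "(\<Sum>k<N. f k) = (\<Sum>k<m. f k)"
  using assms by (intro sum.mono_neutral_right) auto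

lemma mult_extended_vec:
  assumes A: "(A :: complex mat) \<in> carrier_mat N N" and m: "m \<le> N" and s: "s \<in> carrier_vec m" and i: "i < m"
  shows "(A *\<^sub>v vec N (\<lambda>k. if k < m then s $ k else 0)) $ i
    = (submatrix A {..<m} {..<m} *\<^sub>v s) $ i"
proof -
  note Q = leading_submatrix[OF A m]
  have "(A *\<^sub>v vec N (\<lambda>k. if k < m then s $ k else 0)) $ i
      = (\<Sum>k<N. A $$ (i, k) * (if k < m then s $ k else 0))"
    using i m by (subst index_mult_mat_vec_sum[OF A]) auto
  also have "\<dots> = (\<Sum>k<m. A $$ (i, k) * s $ k)"
    by (subst sum_vanishing_above[OF m]) auto
  also have "\<dots> = (submatrix A {..<m} {..<m} *\<^sub>v s) $ i"
    using i by (subst index_mult_mat_vec_sum[OF Q(1) s]) (auto simp: Q(2))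
  finally show ?thesis .
qed

text \<open>If the submatrix \<open>Q\<close> kills \<open>s\<close>, extend \<open>s\<close> by zero to \<open>e\<close> and put \<open>w = \<Phi> e\<close>. Then \<open>w\<close> vanishes on
  the first \<open>m\<close> coordinates and \<open>K w = e\<close> vanishes on the others, so \<open>w = 0\<close>.\<close>

lemma leading_submatrix_inverse:
  assumes Phi: "\<Phi> \<in> carrier_mat N N" and K: "K \<in> carrier_mat N N" "anisotropic K"
    and inv: "K * \<Phi> = 1\<^sub>m N" and m: "m \<le> N"
  defines "Q \<equiv> submatrix \<Phi> {..<m} {..<m}"
  shows "Q * inv_mat Q = 1\<^sub>m m" "inv_mat Q \<in> carrier_mat m m"
proof -
  note Q = leading_submatrix[OF Phi m, folded Q_def]
  have "s = 0\<^sub>v m" if s: "s \<in> carrier_vec m" "Q *\<^sub>v s = 0\<^sub>v m" for s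
  proof -
    define e where "e = vec N (\<lambda>k. if k < m then s $ k else 0)"
    define w where "w = \<Phi> *\<^sub>v e"
    have e: "e \<in> carrier_vec N" and w: "w \<in> carrier_vec N"
      using Phi by (auto simp: e_def w_def)
    have Kw: "K *\<^sub>v w = e"
      unfolding w_def using K Phi e inv by (simp add: assoc_mult_mat_vec[symmetric, of _ N N _ N])
    have "w $ i = 0 \<or> (K *\<^sub>v w) $ i = 0" if "i < N" for i
    proof (cases "i < m")
      case True
      thus ?thesis
        using mult_extended_vec[OF Phi m s(1) True] s(2) by (simp add: w_def e_def Q_def)
    next
      case False
      thus ?thesis unfolding Kw using that by (simp add: e_def)
    qed
    hence "w = 0\<^sub>v N" by (rule anisotropic_complementary_zero[OF K w])
    hence "e = K *\<^sub>v 0\<^sub>v N" using Kw by simp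
    also have "\<dots> = 0\<^sub>v N" using K(1) by auto
    finally have "e = 0\<^sub>v N" .
    show ?thesis
    proof (rule eq_vecI)
      fix i assume "i < dim_vec (0\<^sub>v m :: complex Matrix.vec)"
      hence "i < m" by simp
      have "e $ i = 0" using \<open>e = 0\<^sub>v N\<close> \<open>i < m\<close> m by simp
      thus "s $ i = 0\<^sub>v m $ i" using \<open>i < m\<close> m by (simp add: e_def)
    qed (use s in auto)
  qed
  from inv_mat_of_injective[OF Q(1) this]
  show "Q * inv_mat Q = 1\<^sub>m m" "inv_mat Q \<in> carrier_mat m m" by auto
qed

text \<open>The support of the Schur complement, read off one column at a time. The column \<open>s\<close> of the
  inverse of the leading submatrix belonging to \<open>b\<close>, extended by zero to \<open>e\<close>, equals \<open>K w\<close> for \<open>w = \<Phi> e\<close>, whose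
  coordinates below \<open>m\<close> are those of the unit vector at \<open>b\<close>. The rows of \<open>K w = e\<close> from \<open>m\<close> on say
  that \<open>w\<close> solves a system that is block diagonal there, with right-hand side \<open>-K(\<cdot>, b)\<close>; hence \<open>w\<close>
  vanishes at every index from \<open>m\<close> on whose label is not related to that of \<open>b\<close>. Finally \<open>s\<close> at \<open>a\<close> is
  \<open>K(a, b)\<close> plus the sum of \<open>K(a, k) w(k)\<close> over the indices \<open>k\<close> from \<open>m\<close> on.\<close>

lemma leading_submatrix_inverse_sparse:
  fixes lab :: "nat \<Rightarrow> 'l"
  assumes Phi: "\<Phi> \<in> carrier_mat N N" and K: "K \<in> carrier_mat N N" "anisotropic K"
    and inv: "K * \<Phi> = 1\<^sub>m N" and m: "m \<le> N"
    and sparse: "\<And>i j. i < N \<Longrightarrow> j < N \<Longrightarrow> K $$ (i, j) \<noteq> 0 \<Longrightarrow> R (lab i) (lab j)"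
    and hidden: "\<And>i j. m \<le> i \<Longrightarrow> i < N \<Longrightarrow> m \<le> j \<Longrightarrow> j < N \<Longrightarrow> R (lab i) (lab j) \<Longrightarrow> lab i = lab j"
    and ab: "a < m" "b < m"
    and nz: "inv_mat (submatrix \<Phi> {..<m} {..<m}) $$ (a, b) \<noteq> 0"
  shows "R (lab a) (lab b) \<or> (\<exists>k. m \<le> k \<and> k < N \<and> R (lab a) (lab k) \<and> R (lab k) (lab b))"
proof (rule ccontr)
  assume contr: "\<not> ?thesis"
  define Q where "Q = submatrix \<Phi> {..<m} {..<m}"
  note QS = leading_submatrix_inverse[OF Phi K inv m, folded Q_def]
  note Q = leading_submatrix[OF Phi m, folded Q_def]
  define s where "s = col (inv_mat Q) b"
  define e where "e = vec N (\<lambda>k. if k < m then s $ k else 0)"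
  define w where "w = \<Phi> *\<^sub>v e"
  have s: "s \<in> carrier_vec m" using QS ab by (auto simp: s_def)
  have e: "e \<in> carrier_vec N" and w: "w \<in> carrier_vec N"
    using Phi by (auto simp: e_def w_def)
  have Kw: "K *\<^sub>v w = e"
    unfolding w_def using K Phi e inv by (simp add: assoc_mult_mat_vec[symmetric, of _ N N _ N])
  have w_obs: "w $ i = (if i = b then 1 else 0)" if "i < m" for i
  proof -
    have "w $ i = (Q *\<^sub>v s) $ i"
      using mult_extended_vec[OF Phi m s that] by (simp add: w_def e_def Q_def)
    also have "\<dots> = (Q * inv_mat Q) $$ (i, b)"
      using that ab QS(2) Q(1) by (simp add: s_def)
    finally show ?thesis unfolding QS(1) using that ab by simp
  qed
  define unlinked where "unlinked k \<longleftrightarrow> m \<le> k \<and> k < N \<and> \<not> R (lab k) (lab b)" for k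
  \<comment> \<open>The restriction of \<open>w\<close> to the unlinked coordinates, which is shown to vanish.\<close>
  define v where "v = vec N (\<lambda>k. if unlinked k then w $ k else 0)"
  have v: "v \<in> carrier_vec N" by (simp add: v_def)
  have "(K *\<^sub>v v) $ i = 0" if i: "unlinked i" for i
  proof -
    have iN: "m \<le> i" "i < N" using i by (auto simp: unlinked_def)
    have "0 = (K *\<^sub>v w) $ i" unfolding Kw using iN by (simp add: e_def)
    also have "\<dots> = (\<Sum>k<N. K $$ (i, k) * w $ k)"
      by (rule index_mult_mat_vec_sum[OF K(1) w iN(2)])
    also have "\<dots> = (\<Sum>k<N. K $$ (i, k) * v $ k)"
    proof (rule sum.cong[OF refl])
      fix k assume "k \<in> {..<N}"
      hence k: "k < N" by simp
      show "K $$ (i, k) * w $ k = K $$ (i, k) * v $ k"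
      proof (cases "unlinked k")
        case False
        have "K $$ (i, k) * w $ k = 0"
        proof (cases "k < m")
          case True
          thus ?thesis using w_obs[OF True] sparse[OF iN(2) k] i by (auto simp: unlinked_def)
        next
          case hid: False
          hence "R (lab k) (lab b)" using False k by (simp add: unlinked_def)
          hence "lab i \<noteq> lab k" using i by (auto simp: unlinked_def)
          thus ?thesis using sparse[OF iN(2) k] hidden[OF iN _ k] hid by auto
        qed
        thus ?thesis using False k by (simp add: v_def)
      qed (use k in \<open>simp add: v_def\<close>)
    qed
    also have "\<dots> = (K *\<^sub>v v) $ i"
      by (rule index_mult_mat_vec_sum[OF K(1) v iN(2), symmetric])
    finally show ?thesis by simp
  qed
  hence "v = 0\<^sub>v N"
    by (intro anisotropic_complementary_zero[OF K v]) (auto simp: v_def)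
  have w_hid: "w $ k = 0" if "unlinked k" for k
  proof -
    have "v $ k = 0" using \<open>v = 0\<^sub>v N\<close> that by (simp add: unlinked_def)
    thus ?thesis using that by (simp add: v_def unlinked_def)
  qed
  have "inv_mat Q $$ (a, b) = e $ a"
    using ab m QS by (simp add: e_def s_def)
  also have "\<dots> = (\<Sum>k<N. K $$ (a, k) * w $ k)"
    unfolding Kw[symmetric] using ab m by (intro index_mult_mat_vec_sum[OF K(1) w]) simp
  also have "\<dots> = 0"
  proof (rule sum.neutral, rule ballI)
    fix k assume "k \<in> {..<N}"
    hence k: "k < N" by simp
    have aN: "a < N" using ab m by simp
    show "K $$ (a, k) * w $ k = 0"
    proof (cases "k < m")
      case True
      thus ?thesis using w_obs[OF True] sparse[OF aN k] contr by auto
    next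
      case False
      have "w $ k = 0" if "K $$ (a, k) \<noteq> 0"
        using w_hid[of k] sparse[OF aN k that] contr False k unfolding unlinked_def by force
      thus ?thesis by auto
    qed
  qed
  finally show False using nz by (simp add: Q_def)
qed

lemma invertible_mat_injective:
  assumes G: "G \<in> carrier_mat N N" "invertible_mat G"
    and v: "v \<in> carrier_vec N" and Gv: "G *\<^sub>v v = 0\<^sub>v N"
  shows "v = (0\<^sub>v N :: complex Matrix.vec)"
proof -
  obtain H where H: "inverts_mat H G" "inverts_mat G H" using G(2) by (auto simp: invertible_mat_def)
  have HG: "H * G = 1\<^sub>m (dim_row H)" and GH: "G * H = 1\<^sub>m N"
    using H G by (auto simp: inverts_mat_def)
  have "dim_row H = N" using arg_cong[OF HG, of dim_col] G by simp
  moreover have "dim_col H = N" using arg_cong[OF GH, of dim_col] by simp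
  ultimately have Hc: "H \<in> carrier_mat N N" by auto
  have "v = (H * G) *\<^sub>v v" using HG Hc v by simp
  also have "\<dots> = H *\<^sub>v (G *\<^sub>v v)" using Hc G v by simp
  also have "\<dots> = 0\<^sub>v N" unfolding Gv using Hc by auto
  finally show ?thesis .
qed

text \<open>The inverse spectrum \<open>K = G\<^sup>* F G\<close> of the outputs; \<open>K v\<close> paired with \<open>v\<close> is \<open>F (G v)\<close> paired with \<open>G v\<close>,
  so \<open>K\<close> inherits definiteness from \<open>F\<close>.\<close>

lemma sandwich_inverse:
  assumes G: "G \<in> carrier_mat N N" "invertible_mat G" and Phi: "\<Phi> \<in> carrier_mat N N"
    and E: "\<Phi>E = G * \<Phi> * mat_adjoint G" and F: "F \<in> carrier_mat N N" "\<Phi>E * F = 1\<^sub>m N"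
    and pd: "positive_definite F"
  defines "K \<equiv> mat_adjoint G * F * G"
  shows "K * \<Phi> = 1\<^sub>m N" "K \<in> carrier_mat N N" "anisotropic K"
proof -
  have Ga: "mat_adjoint G \<in> carrier_mat N N" using G(1) by (rule mat_adjoint_dim)
  show K: "K \<in> carrier_mat N N" unfolding K_def
    by (rule mult_carrier_mat[OF mult_carrier_mat[OF Ga F(1)] G(1)])
  have "G * (\<Phi> * mat_adjoint G * F) = 1\<^sub>m N"
    using F(2) G(1) Phi Ga F(1) by (simp add: E assoc_mult_mat[of _ N N _ N _ N])
  hence "\<Phi> * mat_adjoint G * F * G = 1\<^sub>m N"
    using mat_mult_left_right_inverse[OF G(1), of "\<Phi> * mat_adjoint G * F"] Phi Ga F(1) by auto
  hence "\<Phi> * K = 1\<^sub>m N"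
    using G(1) Phi Ga F(1) by (simp add: K_def assoc_mult_mat[of _ N N _ N _ N])
  thus "K * \<Phi> = 1\<^sub>m N" using mat_mult_left_right_inverse[OF Phi K] by simp
  have "v = 0\<^sub>v N" if v: "v \<in> carrier_vec N" and z: "(K *\<^sub>v v) \<bullet>c v = 0" for v
  proof -
    have "K *\<^sub>v v = mat_adjoint G *\<^sub>v (F *\<^sub>v (G *\<^sub>v v))"
      unfolding K_def using G(1) F(1) Ga v by (simp add: assoc_mult_mat_vec[of _ N N _ N])
    hence "(F *\<^sub>v (G *\<^sub>v v)) \<bullet>c (G *\<^sub>v v) = 0"
      using z cscalar_prod_mat_adjoint[OF G(1) v, of "F *\<^sub>v (G *\<^sub>v v)"] F(1) G(1) v by simp
    hence Gv: "G *\<^sub>v v = 0\<^sub>v N"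
      using pd F(1) G(1) v unfolding positive_definite_def
      by (metis carrier_matD(1) less_irrefl mult_mat_vec_carrier)
    thus ?thesis using invertible_mat_injective[OF G v] by blast
  qed
  thus "anisotropic K" using K by (auto simp: anisotropic_def)
qed

section \<open>Factorization of the input spectrum\<close>

lemma sum_blocks:
  fixes f :: "nat \<Rightarrow> complex"
  shows "(\<Sum>k<n * T. f k) = (\<Sum>p<n. \<Sum>u<T. f (p * T + u))"
proof -
  have "sum f {p * T..<p * T + T} = (\<Sum>u<T. f (p * T + u))" for p
    by (rule sum.reindex_bij_witness[of _ "\<lambda>u. p * T + u" "\<lambda>k. k - p * T"]) auto
  thus ?thesis using sum.nat_group[of f T n] by (simp add: mult.commute)
qed

lemma assemble_carrier: "assemble n T F \<in> carrier_mat (n * T) (n * T)"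
  by (simp add: assemble_def)

lemma assemble_index:
  "a < n * T \<Longrightarrow> b < n * T \<Longrightarrow>
    assemble n T F $$ (a, b) = F (a div T) (b div T) $$ (a mod T, b mod T)"
  by (simp add: assemble_def)

lemma block_index_bounds:
  assumes "(a::nat) < n * T"
  shows "a div T < n" "a mod T < T"
proof -
  have "0 < T" using assms by (cases T) auto
  thus "a div T < n" "a mod T < T" using assms by (auto simp: less_mult_imp_div_less)
qed

lemma block_index_less: "p < n \<Longrightarrow> u < T \<Longrightarrow> p * T + u < n * (T::nat)"
proof -
  assume "p < n" "u < T"
  hence "p * T + u < Suc p * T" by simp
  also have "\<dots> \<le> n * T" using \<open>p < n\<close> by (intro mult_le_mono1) simp
  finally show ?thesis .
qed

lemma cross_psd_index:
  assumes "s < T" "t < T"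
  shows "cross_psd M T u v \<omega> $$ (s, t) = phase_sum T \<omega> (\<lambda>k. corr M (u k) (v (int t))) (int s)"
  using assms by (simp add: cross_psd_def phase_sum_def lift_process_def)

lemma lifted_transfer_index:
  assumes "s < T" "t < T"
  shows "lifted_transfer T g \<omega> $$ (s, t) = phase_sum T \<omega> g (int s - int t)"
  using assms by (simp add: lifted_transfer_def phase_sum_def add_diff_eq)

lemma corr_commute: "corr M v u = cnj (corr M u v)"
  unfolding corr_def Bochner_Integration.integral_cnj[symmetric]
  by (simp add: mult.commute del: Bochner_Integration.integral_cnj)

text \<open>The common form of \<open>psd\<close> for two families of processes. The mixed spectra of inputs and
  outputs are the intermediate stage of the factorization.\<close>

definition cross_spectrum where
  "cross_spectrum M n T u v \<omega> = assemble n T (\<lambda>i j. cross_psd M T (u i) (v j) \<omega>)"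

lemma cross_spectrum_index:
  assumes "a < n * T" "b < n * T"
  shows "cross_spectrum M n T u v \<omega> $$ (a, b) =
    phase_sum T \<omega> (\<lambda>k. corr M (u (a div T) k) (v (b div T) (int (b mod T)))) (int (a mod T))"
  using assms block_index_bounds[OF assms(1)] block_index_bounds[OF assms(2)]
  by (simp add: cross_spectrum_def assemble_index cross_psd_index)

lemma phase_sum_filter_bank:
  assumes T: "0 < T" and g: "\<And>p. p < n \<Longrightarrow> g p summable_on UNIV"
    and R: "\<And>p. p < n \<Longrightarrow> R p summable_on UNIV"
  shows "phase_sum T \<omega> (\<lambda>k. \<Sum>p<n. \<Sum>\<^sub>\<infinity>l. g p l * R p (k - l)) s =
    (\<Sum>p<n. \<Sum>u<T. phase_sum T \<omega> (g p) (s - int u) * phase_sum T \<omega> (R p) (int u))"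
proof -
  have "(\<lambda>\<kappa>. (\<Sum>\<^sub>\<infinity>l. g p l * R p (\<kappa> * int T + s - l)) * cis (- \<omega> * real_of_int \<kappa>)) summable_on UNIV"
    if "p < n" for p
    by (rule phase_summable[OF has_sum_imp_summable[OF convolution_has_sum[OF g[OF that] R[OF that]]] T])
  from has_sum_infsum[OF this]
  have "phase_sum T \<omega> (\<lambda>k. \<Sum>p<n. \<Sum>\<^sub>\<infinity>l. g p l * R p (k - l)) s =
      (\<Sum>p<n. phase_sum T \<omega> (\<lambda>k. \<Sum>\<^sub>\<infinity>l. g p l * R p (k - l)) s)"
    unfolding phase_sum_def sum_distrib_right
    by (intro infsumI has_sum_finite_sum) simp
  also have "\<dots> = (\<Sum>p<n. \<Sum>u<T. phase_sum T \<omega> (g p) (s - int u) * phase_sum T \<omega> (R p) (int u))"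
    by (intro sum.cong refl phase_sum_convolution T g R) auto
  finally show ?thesis .
qed

text \<open>Filtering the first family multiplies the cross spectrum by the transfer matrix from the left.\<close>

lemma cross_spectrum_filtered:
  assumes T: "0 < T"
    and g: "\<And>i p. i < n \<Longrightarrow> p < n \<Longrightarrow> g i p summable_on UNIV"
    and R: "\<And>p j t. p < n \<Longrightarrow> j < n \<Longrightarrow> (\<lambda>k. corr M (x p k) (z j t)) summable_on UNIV"
    and y: "\<And>i j k t. i < n \<Longrightarrow> j < n \<Longrightarrow>
      corr M (y i k) (z j t) = (\<Sum>p<n. \<Sum>\<^sub>\<infinity>l. g i p l * corr M (x p (k - l)) (z j t))"
  shows "cross_spectrum M n T y z \<omega> =
    assemble n T (\<lambda>i p. lifted_transfer T (g i p) \<omega>) * cross_spectrum M n T x z \<omega>"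
    (is "_ = ?G * ?X")
proof (rule eq_matI)
  note G = assemble_carrier[of n T "\<lambda>i p. lifted_transfer T (g i p) \<omega>"]
  have X: "?X \<in> carrier_mat (n * T) (n * T)" by (simp add: cross_spectrum_def assemble_carrier)
  fix a b assume "a < dim_row (?G * ?X)" "b < dim_col (?G * ?X)"
  hence ab: "a < n * T" "b < n * T" using G X by auto
  note a = block_index_bounds[OF ab(1)] and b = block_index_bounds[OF ab(2)]
  let ?z = "z (b div T) (int (b mod T))"
  have "cross_spectrum M n T y z \<omega> $$ (a, b) =
      phase_sum T \<omega> (\<lambda>k. \<Sum>p<n. \<Sum>\<^sub>\<infinity>l. g (a div T) p l * corr M (x p (k - l)) ?z) (int (a mod T))"
    by (simp only: cross_spectrum_index[OF ab] y[OF a(1) b(1)])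
  also have "\<dots> = (\<Sum>p<n. \<Sum>u<T. phase_sum T \<omega> (g (a div T) p) (int (a mod T) - int u) *
      phase_sum T \<omega> (\<lambda>k. corr M (x p k) ?z) (int u))"
    by (rule phase_sum_filter_bank[OF T g[OF a(1)] R[OF _ b(1)]])
  also have "\<dots> = (\<Sum>p<n. \<Sum>u<T. ?G $$ (a, p * T + u) * ?X $$ (p * T + u, b))"
    using a by (intro sum.cong refl)
      (simp add: assemble_index cross_spectrum_index ab block_index_less lifted_transfer_index)
  also have "\<dots> = (?G * ?X) $$ (a, b)"
    unfolding index_mult_mat_sum[OF G X ab] sum_blocks ..
  finally show "cross_spectrum M n T y z \<omega> $$ (a, b) = (?G * ?X) $$ (a, b)" .
qed (simp_all add: cross_spectrum_def assemble_def)

text \<open>By shift invariance the correlation of \<open>v\<close> at time \<open>\<kappa> T + s\<close> with \<open>u\<close> at time \<open>t\<close> is the conjugate of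
  that of \<open>u\<close> at time \<open>-\<kappa> T + t\<close> with \<open>v\<close> at time \<open>s\<close>; conjugating the Fourier series undoes the
  change of sign of \<open>\<kappa>\<close>.\<close>

lemma cross_spectrum_adjoint:
  assumes shift: "\<And>i j k l. i < n \<Longrightarrow> j < n \<Longrightarrow>
      corr M (u i (k + int T)) (v j (l + int T)) = corr M (u i k) (v j l)"
  shows "cross_spectrum M n T v u \<omega> = mat_adjoint (cross_spectrum M n T u v \<omega>)"
proof (rule eq_matI)
  have C: "cross_spectrum M n T u v \<omega> \<in> carrier_mat (n * T) (n * T)" for u v
    by (simp add: cross_spectrum_def assemble_carrier)
  fix a b assume "a < dim_row (mat_adjoint (cross_spectrum M n T u v \<omega>))"
    "b < dim_col (mat_adjoint (cross_spectrum M n T u v \<omega>))"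
  hence ab: "a < n * T" "b < n * T" using mat_adjoint_dim[OF C[of u v]] by auto
  note a = block_index_bounds[OF ab(1)] and b = block_index_bounds[OF ab(2)]
  have eq: "corr M (v (a div T) (\<kappa> * int T + int (a mod T))) (u (b div T) (int (b mod T))) =
    cnj (corr M (u (b div T) (- \<kappa> * int T + int (b mod T))) (v (a div T) (int (a mod T))))" for \<kappa>
    using shift_by_multiple[of "\<lambda>k l. corr M (u (b div T) k) (v (a div T) l)" "int T"
        "int (b mod T)" "- \<kappa>" "\<kappa> * int T + int (a mod T)"] shift[OF b(1) a(1)]
    by (simp add: corr_commute[of M "v _ _"] add.commute)
  have "cross_spectrum M n T v u \<omega> $$ (a, b) = (\<Sum>\<^sub>\<infinity>\<kappa>.
      cnj (corr M (u (b div T) (- \<kappa> * int T + int (b mod T))) (v (a div T) (int (a mod T)))) *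
      cis (- \<omega> * real_of_int \<kappa>))"
    unfolding cross_spectrum_index[OF ab] phase_sum_def eq ..
  also have "\<dots> = (\<Sum>\<^sub>\<infinity>\<kappa>.
      cnj (corr M (u (b div T) (\<kappa> * int T + int (b mod T))) (v (a div T) (int (a mod T))) *
      cis (- \<omega> * real_of_int \<kappa>)))"
    by (rule infsum_reindex_bij_witness[of _ uminus uminus]) (auto simp: cis_cnj)
  also have "\<dots> = cnj (cross_spectrum M n T u v \<omega> $$ (b, a))"
    unfolding infsum_cnj cross_spectrum_index[OF ab(2,1)] phase_sum_def ..
  also have "\<dots> = mat_adjoint (cross_spectrum M n T u v \<omega>) $$ (a, b)"
    using mat_adjoint_index[OF C ab] by simp
  finally show "cross_spectrum M n T v u \<omega> $$ (a, b) =
      mat_adjoint (cross_spectrum M n T u v \<omega>) $$ (a, b)" .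
qed (use mat_adjoint_dim[of "cross_spectrum M n T u v \<omega>" "n * T" "n * T"] in
    \<open>simp_all add: cross_spectrum_def assemble_def mat_adjoint_def\<close>)

lemma whitening_matrix:
  "1\<^sub>m (n * T) - transfer_matrix n T h \<omega> =
    assemble n T (\<lambda>i j. lifted_transfer T (whitening_kernel h i j) \<omega>)" (is "?L = ?R")
proof (rule eq_matI)
  fix a b assume "a < dim_row ?R" "b < dim_col ?R"
  hence ab: "a < n * T" "b < n * T" by (auto simp: assemble_def)
  note a = block_index_bounds[OF ab(1)] and b = block_index_bounds[OF ab(2)]
  have L: "?L $$ (a, b) = (if a = b then 1 else 0) -
      (if a div T = b div T then 0 else phase_sum T \<omega> (h (a div T) (b div T)) (int (a mod T) - int (b mod T)))"
    using ab a b by (simp add: transfer_matrix_def assemble_index assemble_carrier[THEN carrier_matD(1)]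
        assemble_carrier[THEN carrier_matD(2)] lifted_transfer_index)
  have R: "?R $$ (a, b) = phase_sum T \<omega> (whitening_kernel h (a div T) (b div T)) (int (a mod T) - int (b mod T))"
    using ab a b by (simp add: assemble_index lifted_transfer_index)
  show "?L $$ (a, b) = ?R $$ (a, b)"
  proof (cases "a div T = b div T")
    case False
    hence "a \<noteq> b" by auto
    have "phase_sum T \<omega> (whitening_kernel h (a div T) (b div T)) r = - phase_sum T \<omega> (h (a div T) (b div T)) r" for r
      using False by (simp add: phase_sum_def whitening_kernel_def infsum_uminus)
    thus ?thesis using False \<open>a \<noteq> b\<close> unfolding L R by simp
  next
    case True
    have eq: "a = b \<longleftrightarrow> a mod T = b mod T" using True by (metis div_mult_mod_eq)
    \<comment> \<open>The residues differ by less than \<open>T\<close>, so only \<open>\<kappa> = 0\<close> can hit the unit impulse.\<close>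
    have zero: "\<kappa> * int T + (int (a mod T) - int (b mod T)) = 0 \<longleftrightarrow> \<kappa> = 0 \<and> a = b" for \<kappa> :: int
    proof
      assume z: "\<kappa> * int T + (int (a mod T) - int (b mod T)) = 0"
      have "int (b mod T) = (int (a mod T) + \<kappa> * int T)" using z by simp
      hence "int (b mod T) mod int T = int (a mod T) mod int T" by simp
      hence ab': "b mod T = a mod T" using a b by simp
      moreover have "\<kappa> = 0" using z ab' a by auto
      ultimately show "\<kappa> = 0 \<and> a = b" using eq by simp
    qed auto
    have "?R $$ (a, b) = (\<Sum>\<^sub>\<infinity>\<kappa>. (if \<kappa> = 0 then 1 else 0) * ((if a = b then 1 else 0) * cis (- \<omega> * real_of_int \<kappa>)))"
      unfolding R phase_sum_def whitening_kernel_def using True zero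
      by (intro infsum_cong) auto
    also have "\<dots> = (if a = b then 1 else 0)"
      by (subst infsum_delta_mult) simp
    finally show ?thesis using True unfolding L by simp
  qed
qed (simp_all add: transfer_matrix_def assemble_def)

lemma whitening_kernel_summable:
  assumes "nlds M n per h x \<epsilon>" "i < n" "p < n"
  shows "whitening_kernel h i p summable_on UNIV"
proof (cases "i = p")
  case True
  have "whitening_kernel h i p summable_on {0}" by simp
  thus ?thesis
    using True by (subst summable_on_cong_neutral[of "{0}" UNIV "whitening_kernel h i p" "whitening_kernel h i p"])
      (auto simp: whitening_kernel_def)
next
  case False
  hence "h i p summable_on UNIV"
    using assms unfolding nlds_def summable_on_iff_abs_summable_on_complex by blast
  hence "(\<lambda>l. - h i p l) summable_on UNIV" by (simp add: summable_on_uminus)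
  moreover have "whitening_kernel h i p = (\<lambda>l. - h i p l)"
    using False by (intro ext) (simp add: whitening_kernel_def)
  ultimately show ?thesis by simp
qed

text \<open>The filter is applied twice: once to pass from the spectrum of the outputs to the cross spectrum
  of inputs and outputs, and, after taking adjoints, once more to reach the spectrum of the inputs.
  The periodicity and the summability of the mixed correlations that the second application requires
  come out of the first.\<close>

lemma psd_factorization:
  assumes sys: "nlds M n per h x \<epsilon>" and T: "T = Lcm (per ` {..<n})"
  defines "G \<equiv> \<lambda>\<omega>. 1\<^sub>m (n * T) - transfer_matrix n T h \<omega>"
  shows "psd M n T \<epsilon> \<omega> = G \<omega> * psd M n T x \<omega> * mat_adjoint (G \<omega>)"
proof -
  have G: "G \<omega> = assemble n T (\<lambda>i p. lifted_transfer T (whitening_kernel h i p) \<omega>)"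
    unfolding G_def by (rule whitening_matrix)
  have Gc: "G \<omega> \<in> carrier_mat (n * T) (n * T)" unfolding G by (rule assemble_carrier)
  have psd: "psd M n T u \<omega> = cross_spectrum M n T u u \<omega>" for u
    by (simp add: psd_def cross_spectrum_def)
  have C: "cross_spectrum M n T u v \<omega> \<in> carrier_mat (n * T) (n * T)" for u v
    by (simp add: cross_spectrum_def assemble_carrier)
  have cyc: "jointly_cyclostationary M T {..<n} x" using sys T by (simp add: nlds_def)
  have T0: "0 < T" using cyc by (simp add: jointly_cyclostationary_def)
  have xx: "corr M (x i (k + int T)) (x j (l + int T)) = corr M (x i k) (x j l)"
    if "i < n" "j < n" for i j k l
    using cyc that by (simp add: jointly_cyclostationary_def)
  have x: "x i k \<in> borel_measurable M" "integrable M (\<lambda>a. (norm (x i k a))\<^sup>2)" if "i < n" for i k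
    using cyc that by (simp_all add: jointly_cyclostationary_def)
  have e: "\<epsilon> i k \<in> borel_measurable M" "integrable M (\<lambda>a. (norm (\<epsilon> i k a))\<^sup>2)" if "i < n" for i k
  proof -
    have "jointly_cyclostationary M (per i) {i} \<epsilon>" using sys that by (simp add: nlds_def)
    thus "\<epsilon> i k \<in> borel_measurable M" "integrable M (\<lambda>a. (norm (\<epsilon> i k a))\<^sup>2)"
      by (simp_all add: jointly_cyclostationary_def)
  qed
  note filter = corr_input[OF sys]
  note g = whitening_kernel_summable[OF sys]
  have sxx: "(\<lambda>k. corr M (x p k) (x j t)) summable_on UNIV" if "p < n" "j < n" for p j t
  proof -
    have s: "(\<lambda>\<tau>. corr M (x p (t + \<tau>)) (x j t)) summable_on UNIV"
      using sys that unfolding nlds_def summable_correlations_def summable_on_iff_abs_summable_on_complex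
      by blast
    show ?thesis
      using summable_on_inj_comp[OF s, of "\<lambda>k. k - t"] by (simp add: inj_def)
  qed
  have ex: "corr M (\<epsilon> i (k + int T)) (x j (l + int T)) = corr M (\<epsilon> i k) (x j l)"
    if "i < n" "j < n" for i j k l
    unfolding filter[OF that(1) x[OF that(2)]]
    using xx[OF _ that(2), of _ "k - _"] by (simp add: algebra_simps)
  have sex: "(\<lambda>k. corr M (\<epsilon> i k) (x j t)) summable_on UNIV" if "i < n" "j < n" for i j t
    unfolding filter[OF that(1) x[OF that(2)]]
    by (rule has_sum_imp_summable, rule has_sum_finite_sum,
        rule convolution_has_sum) (use g sxx that in auto)
  have sxe: "(\<lambda>k. corr M (x p k) (\<epsilon> j t)) summable_on UNIV" if "p < n" "j < n" for p j t
  proof -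
    have "(\<lambda>k. corr M (\<epsilon> j t) (x p k)) summable_on UNIV"
      by (rule summable_on_second_argument[OF T0, where F = "\<lambda>k l. corr M (\<epsilon> j k) (x p l)"])
        (use shift_by_multiple[of "\<lambda>k l. corr M (\<epsilon> j k) (x p l)" "int T"] ex sex that in auto)
    thus ?thesis by (subst corr_commute) simp
  qed
  have 1: "cross_spectrum M n T \<epsilon> x \<omega> = G \<omega> * cross_spectrum M n T x x \<omega>"
    unfolding G by (rule cross_spectrum_filtered[OF T0 g sxx filter[OF _ x]])
  have 2: "cross_spectrum M n T \<epsilon> \<epsilon> \<omega> = G \<omega> * cross_spectrum M n T x \<epsilon> \<omega>"
    unfolding G by (rule cross_spectrum_filtered[OF T0 g sxe filter[OF _ e]])
  have "cross_spectrum M n T x \<epsilon> \<omega> = mat_adjoint (cross_spectrum M n T \<epsilon> x \<omega>)"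
    by (rule cross_spectrum_adjoint) (rule ex)
  also have "\<dots> = mat_adjoint (cross_spectrum M n T x x \<omega>) * mat_adjoint (G \<omega>)"
    unfolding 1 by (rule mat_adjoint_mult[OF Gc C])
  also have "mat_adjoint (cross_spectrum M n T x x \<omega>) = cross_spectrum M n T x x \<omega>"
    by (rule cross_spectrum_adjoint[symmetric]) (rule xx)
  finally show ?thesis
    unfolding psd 2 by (simp add: assoc_mult_mat[OF Gc C mat_adjoint_dim[OF Gc]])
qed

lemma input_psd_block_diagonal:
  assumes sys: "nlds M n per h x \<epsilon>" and ab: "a < n * T" "b < n * T" "a div T \<noteq> b div T"
  shows "psd M n T \<epsilon> \<omega> $$ (a, b) = 0"
proof -
  note a = block_index_bounds[OF ab(1)] and b = block_index_bounds[OF ab(2)]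
  have "corr M (\<epsilon> (a div T) k) (\<epsilon> (b div T) l) = 0" for k l
    using sys a b ab(3) by (simp add: nlds_def)
  moreover have "psd M n T \<epsilon> \<omega> = cross_spectrum M n T \<epsilon> \<epsilon> \<omega>"
    by (simp add: psd_def cross_spectrum_def)
  ultimately show ?thesis
    by (simp add: cross_spectrum_index[OF ab(1,2)] phase_sum_def)
qed

section \<open>Support of the inverse observed spectrum\<close>

lemma block_nonzeroD:
  assumes "block T A i j \<noteq> 0\<^sub>m T T"
  obtains s t where "s < T" "t < T" "A $$ (i * T + s, j * T + t) \<noteq> 0"
proof -
  have "\<exists>s<T. \<exists>t<T. A $$ (i * T + s, j * T + t) \<noteq> 0"
  proof (rule ccontr)
    assume "\<not> ?thesis"
    hence "block T A i j = 0\<^sub>m T T" by (intro eq_matI) (auto simp: block_def)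
    thus False using assms by simp
  qed
  thus thesis using that by blast
qed

lemma block_nonzeroI:
  assumes "A $$ (a, b) \<noteq> 0" "0 < T"
  shows "block T A (a div T) (b div T) \<noteq> 0\<^sub>m T T"
proof
  assume "block T A (a div T) (b div T) = 0\<^sub>m T T"
  hence "block T A (a div T) (b div T) $$ (a mod T, b mod T) = 0" using assms(2) by simp
  thus False using assms by (simp add: block_def)
qed

lemma transfer_block_diagonal:
  assumes "i < n"
  shows "block T (transfer_matrix n T h \<omega>) i i = 0\<^sub>m T T"
  using assms by (intro eq_matI) (auto simp: block_def transfer_matrix_def assemble_index block_index_less)

text \<open>The edges and loops of the moral graph of the network: \<open>i\<close> and \<open>j\<close> are equal or adjacent, or
  have a common neighbour \<open>k\<close>. The witness \<open>k\<close> is the summation index at which both factors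
  \<open>G(k, i)\<^sup>*\<close> and \<open>G(k, j)\<close> of the block \<open>(i, j)\<close> of \<open>G\<^sup>* \<Phi>\<^sub>E\<^sup>-\<^sup>1 G\<close> are nonzero.\<close>

definition linked :: "nat \<Rightarrow> (nat \<Rightarrow> nat \<Rightarrow> bool) \<Rightarrow> nat \<Rightarrow> nat \<Rightarrow> bool" where
  "linked n adj i j \<longleftrightarrow> (\<exists>k<n. (k = i \<or> adj k i) \<and> (k = j \<or> adj k j))"

text \<open>One frequency at a time: the sparsity of \<open>G\<^sup>* \<Phi>\<^sub>E\<^sup>-\<^sup>1 G\<close>, combined with the Schur complement argument
  for the labelling of scalar indices by the node \<open>a div T\<close>.\<close>

lemma inverse_observed_psd_sparse:
  assumes sys: "nlds M n per h x \<epsilon>" and T: "T = Lcm (per ` {..<n})" and m: "m \<le> n"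
    and inv: "invertible_mat (psd M n T \<epsilon> \<omega>)" "positive_definite (inv_mat (psd M n T \<epsilon> \<omega>))"
      "invertible_mat (1\<^sub>m (n * T) - transfer_matrix n T h \<omega>)"
    and adj: "\<And>i j. i < n \<Longrightarrow> j < n \<Longrightarrow> block T (transfer_matrix n T h \<omega>) i j \<noteq> 0\<^sub>m T T \<Longrightarrow> adj i j"
    and hidden: "\<And>i j. m \<le> i \<Longrightarrow> i < n \<Longrightarrow> m \<le> j \<Longrightarrow> j < n \<Longrightarrow> linked n adj i j \<Longrightarrow> i = j"
    and ij: "i < m" "j < m"
    and nz: "block T (inv_mat (observed_psd M n m T x \<omega>)) i j \<noteq> 0\<^sub>m T T"
  shows "linked n adj i j \<or> (\<exists>d. m \<le> d \<and> d < n \<and> linked n adj i d \<and> linked n adj d j)"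
proof -
  define N where "N = n * T"
  define G where "G = 1\<^sub>m N - transfer_matrix n T h \<omega>"
  define \<Phi> where "\<Phi> = psd M n T x \<omega>"
  define F where "F = inv_mat (psd M n T \<epsilon> \<omega>)"
  define K where "K = mat_adjoint G * F * G"
  have tc: "transfer_matrix n T h \<omega> \<in> carrier_mat N N"
    by (simp add: transfer_matrix_def assemble_carrier N_def)
  have Gc: "G \<in> carrier_mat N N" unfolding G_def using tc by auto
  have Phic: "\<Phi> \<in> carrier_mat N N" and Ec: "psd M n T \<epsilon> \<omega> \<in> carrier_mat N N"
    unfolding \<Phi>_def psd_def N_def by (rule assemble_carrier)+
  note F = inv_mat_of_injective[OF Ec invertible_mat_injective[OF Ec inv(1)], folded F_def]
  have factor: "psd M n T \<epsilon> \<omega> = G * \<Phi> * mat_adjoint G"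
    using psd_factorization[OF sys T] unfolding G_def \<Phi>_def N_def .
  note K = sandwich_inverse[OF Gc inv(3)[folded N_def, folded G_def] Phic factor F(3,1)
      inv(2)[folded F_def], folded K_def]
  have T0: "0 < T" using sys T by (simp add: nlds_def jointly_cyclostationary_def)
  have Fdiag: "F $$ (a, b) = 0" if "a < N" "b < N" "a div T \<noteq> b div T" for a b
    by (rule inverse_of_label_diagonal[OF Ec F(3,1,2), where lab = "\<lambda>a. a div T"])
      (use input_psd_block_diagonal[OF sys] that in \<open>auto simp: N_def\<close>)
  have Gadj: "a div T = b div T \<or> adj (a div T) (b div T)" if "a < N" "b < N" "G $$ (a, b) \<noteq> 0" for a b
  proof (cases "a = b")
    case False
    hence "transfer_matrix n T h \<omega> $$ (a, b) \<noteq> 0" using that tc by (auto simp: G_def)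
    from adj[OF _ _ block_nonzeroI[OF this T0]] show ?thesis
      using that block_index_bounds(1) unfolding N_def by blast
  qed simp
  have sparse: "linked n adj (a div T) (b div T)" if ab: "a < N" "b < N" and K0: "K $$ (a, b) \<noteq> 0" for a b
  proof -
    note GF = mult_carrier_mat[OF mat_adjoint_dim[OF Gc] F(3)]
    have "K $$ (a, b) = (\<Sum>k<N. (mat_adjoint G * F) $$ (a, k) * G $$ (k, b))"
      unfolding K_def by (rule index_mult_mat_sum[OF GF Gc ab])
    hence "(\<Sum>k<N. (mat_adjoint G * F) $$ (a, k) * G $$ (k, b)) \<noteq> 0"
      using K0 by simp
    then obtain k where k: "k < N" "(mat_adjoint G * F) $$ (a, k) \<noteq> 0" "G $$ (k, b) \<noteq> 0"
      by (auto elim!: sum.not_neutral_contains_not_neutral)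
    have "(\<Sum>l<N. mat_adjoint G $$ (a, l) * F $$ (l, k)) \<noteq> 0"
      using k(2) index_mult_mat_sum[OF mat_adjoint_dim[OF Gc] F(3) ab(1) k(1)] by simp
    then obtain l where l: "l < N" "mat_adjoint G $$ (a, l) \<noteq> 0" "F $$ (l, k) \<noteq> 0"
      by (auto elim!: sum.not_neutral_contains_not_neutral)
    have "G $$ (l, a) \<noteq> 0" using l mat_adjoint_index[OF Gc ab(1) l(1)] by simp
    moreover have "l div T = k div T" using Fdiag[OF l(1) k(1)] l(3) by blast
    moreover have "k div T < n" using block_index_bounds(1) k(1) unfolding N_def by blast
    ultimately show ?thesis
      using Gadj[OF l(1) ab(1)] Gadj[OF k(1) ab(2) k(3)] unfolding linked_def by auto
  qed
  obtain s t where st: "s < T" "t < T" "inv_mat (observed_psd M n m T x \<omega>) $$ (i * T + s, j * T + t) \<noteq> 0"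
    using block_nonzeroD[OF nz] .
  have mT: "m * T \<le> N" using m by (simp add: N_def)
  have hid: "m \<le> a div T" "a div T < n" if "m * T \<le> a" "a < N" for a
    using that T0 block_index_bounds(1) unfolding N_def
    by (simp_all add: less_eq_div_iff_mult_less_eq)
  have "linked n adj ((i * T + s) div T) ((j * T + t) div T) \<or>
      (\<exists>k. m * T \<le> k \<and> k < N \<and> linked n adj ((i * T + s) div T) (k div T) \<and>
        linked n adj (k div T) ((j * T + t) div T))"
  proof (rule leading_submatrix_inverse_sparse[OF Phic K(2,3,1) mT, where lab = "\<lambda>a. a div T"])
    show "linked n adj (a div T) (b div T)" if "a < N" "b < N" "K $$ (a, b) \<noteq> 0" for a b
      using sparse[OF that] .
    show "a div T = b div T"
      if "m * T \<le> a" "a < N" "m * T \<le> b" "b < N" "linked n adj (a div T) (b div T)" for a b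
      using hidden hid that by blast
    show "inv_mat (submatrix \<Phi> {..<m * T} {..<m * T}) $$ (i * T + s, j * T + t) \<noteq> 0"
      using st(3) unfolding observed_psd_def \<Phi>_def .
  qed (use ij st block_index_less in auto)
  moreover have "(i * T + s) div T = i" "(j * T + t) div T = j" using st by auto
  ultimately show ?thesis using hid by metis
qed

text \<open>Each of the finitely many identically vanishing transfer blocks vanishes at almost every
  frequency, so the pointwise sparsity statement applies with one and the same graph almost everywhere.\<close>

lemma inverse_psd_graph_edge:
  assumes sys: "nlds M n per h x \<epsilon>" and T: "T = Lcm (per ` {..<n})" and m: "m \<le> n"
    and wp: "well_posed_detectable M n T h \<epsilon>"
    and adj: "\<And>i j. i < n \<Longrightarrow> j < n \<Longrightarrow> nonzero_block T (transfer_matrix n T h) i j \<Longrightarrow> adj i j"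
    and hidden: "\<And>i j. m \<le> i \<Longrightarrow> i < n \<Longrightarrow> m \<le> j \<Longrightarrow> j < n \<Longrightarrow> linked n adj i j \<Longrightarrow> i = j"
    and ij: "i < m" "j < m"
    and nz: "nonzero_block T (\<lambda>\<omega>. inv_mat (observed_psd M n m T x \<omega>)) i j"
  shows "linked n adj i j \<or> (\<exists>d. m \<le> d \<and> d < n \<and> linked n adj i d \<and> linked n adj d j)"
proof (rule ccontr)
  assume contr: "\<not> ?thesis"
  define P where "P = {p \<in> {..<n} \<times> {..<n}. \<not> nonzero_block T (transfer_matrix n T h) (fst p) (snd p)}"
  have "finite P" by (simp add: P_def)
  hence "AE \<omega> in lborel. \<forall>p\<in>P. \<omega> \<in> {0..<2 * pi} \<longrightarrow>
      block T (transfer_matrix n T h \<omega>) (fst p) (snd p) = 0\<^sub>m T T"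
    by (intro AE_finite_allI) (auto simp: P_def nonzero_block_def)
  with wp[unfolded well_posed_detectable_def]
  have "AE \<omega>\<in>{0..<2 * pi} in lborel. block T (inv_mat (observed_psd M n m T x \<omega>)) i j = 0\<^sub>m T T"
  proof eventually_elim
    case (elim \<omega>)
    show ?case
    proof (intro impI, rule ccontr)
      assume \<omega>: "\<omega> \<in> {0..<2 * pi}" and nz: "block T (inv_mat (observed_psd M n m T x \<omega>)) i j \<noteq> 0\<^sub>m T T"
      have a: "adj k l" if "k < n" "l < n" "block T (transfer_matrix n T h \<omega>) k l \<noteq> 0\<^sub>m T T" for k l
        using elim(2) \<omega> that adj[OF that(1,2)] by (auto simp: P_def)
      have "linked n adj i j \<or> (\<exists>d. m \<le> d \<and> d < n \<and> linked n adj i d \<and> linked n adj d j)"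
        by (rule inverse_observed_psd_sparse[OF sys T m _ _ _ a hidden ij nz]) (use elim(1) \<omega> in auto)
      thus False using contr by blast
    qed
  qed
  thus False using nz by (simp add: nonzero_block_def)
qed

lemma linked_imp_walk:
  assumes sym: "\<And>u v. adj u v \<Longrightarrow> adj v u" and "linked n adj i j"
  shows "\<exists>k\<le>2. (adj ^^ k) i j"
proof -
  obtain k where k: "k = i \<or> adj k i" "k = j \<or> adj k j" using assms(2) by (auto simp: linked_def)
  have "(adj ^^ 0) i j" if "i = j" using that by simp
  moreover have one: "(adj ^^ 1) u v" if "adj u v" for u v using that by (simp only: relpowp_1)
  moreover have "(adj ^^ 2) i j" if "adj i k" "adj k j"
    using relpowp_Suc_I[OF one[OF that(1)] that(2)] by (simp only: Suc_1)
  ultimately show ?thesis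
    using k sym by (cases "i = k"; cases "k = j") (metis le_refl one_le_numeral zero_le_numeral)+
qed

section \<open>Paths in trees\<close>

text \<open>Paths as lists of vertices, which can be reversed, split and prolonged more easily than lists of
  arcs.\<close>

definition vertex_path :: "'v set \<Rightarrow> ('v \<Rightarrow> 'v \<Rightarrow> bool) \<Rightarrow> 'v \<Rightarrow> 'v list \<Rightarrow> 'v \<Rightarrow> bool" where
  "vertex_path V adj u xs v \<longleftrightarrow> xs \<noteq> [] \<and> hd xs = u \<and> last xs = v \<and> distinct xs \<and> set xs \<subseteq> V \<and>
     successively adj xs"

locale path_tree =
  fixes V :: "'v set" and adj :: "'v \<Rightarrow> 'v \<Rightarrow> bool"
  assumes adj_in_V: "adj u v \<Longrightarrow> v \<in> V"
    and adj_sym: "adj u v \<Longrightarrow> adj v u"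
    and adj_irrefl: "\<not> adj u u"
    and connected: "u \<in> V \<Longrightarrow> v \<in> V \<Longrightarrow> \<exists>xs. vertex_path V adj u xs v"
    and unique: "vertex_path V adj u xs v \<Longrightarrow> vertex_path V adj u ys v \<Longrightarrow> xs = ys"
begin

abbreviation path :: "'v \<Rightarrow> 'v list \<Rightarrow> 'v \<Rightarrow> bool" where
  "path \<equiv> vertex_path V adj"

lemma path_rev: "path u xs v \<Longrightarrow> path v (rev xs) u"
  unfolding vertex_path_def using adj_sym
  by (auto simp: successively_rev hd_rev last_rev elim!: successively_mono)

lemma path_suffix: "path u (xs @ y # ys) v \<Longrightarrow> path y (y # ys) v"
  unfolding vertex_path_def by (auto simp: successively_append_iff split: if_splits)

lemma path_prefix: "path u (xs @ y # ys) v \<Longrightarrow> path u (xs @ [y]) y"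
  unfolding vertex_path_def by (auto simp: successively_append_iff hd_append split: if_splits)

lemma path_snoc:
  assumes "path u xs v" "adj v w" "w \<notin> set xs"
  shows "path u (xs @ [w]) w"
  using assms adj_in_V unfolding vertex_path_def by (auto simp: successively_append_iff)

text \<open>A neighbour \<open>w\<close> of the end other than its predecessor is a new vertex: had the path met \<open>w\<close>
  before, its part from \<open>w\<close> on and the single edge would be two different paths from \<open>w\<close> to \<open>v\<close>.\<close>

lemma path_extend:
  assumes p: "path u (xs @ [a, v]) v" and adj: "adj v w" and ne: "w \<noteq> a"
  shows "path u (xs @ [a, v, w]) w"
proof -
  have "w \<notin> set (xs @ [a, v])"
  proof
    assume "w \<in> set (xs @ [a, v])"
    moreover have "w \<noteq> v" using adj adj_irrefl by auto
    ultimately have "w \<in> set xs" using ne by auto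
    then obtain ys zs where xs: "xs = ys @ w # zs" by (meson split_list)
    have "path w (w # zs @ [a, v]) v"
      using p path_suffix[of u ys w "zs @ [a, v]" v] unfolding xs by simp
    moreover have "path w [w, v] v"
      using adj adj_sym[OF adj] adj_in_V[OF adj] adj_in_V[OF adj_sym[OF adj]] \<open>w \<noteq> v\<close>
      unfolding vertex_path_def by simp
    ultimately have "w # zs @ [a, v] = [w, v]" by (rule unique)
    thus False by simp
  qed
  from path_snoc[OF p adj this] show ?thesis by simp
qed

lemma path_of_walk:
  assumes "(adj ^^ k) u v" "u \<in> V"
  shows "\<exists>xs. path u xs v \<and> length xs \<le> Suc k"
  using assms
proof (induction k arbitrary: v)
  case 0
  hence "path u [u] v" unfolding vertex_path_def by simp
  thus ?case by force
next
  case (Suc k)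
  obtain w where "(adj ^^ k) u w" and adj: "adj w v"
    using Suc.prems(1) by (auto elim: relpowp_Suc_E)
  from Suc.IH[OF this(1) Suc.prems(2)] obtain xs
    where w: "adj w v" "path u xs w" "length xs \<le> Suc k" using adj by blast
  show ?case
  proof (cases "v \<in> set xs")
    case True
    then obtain ys zs where xs: "xs = ys @ v # zs" by (meson split_list)
    have "path u (ys @ [v]) v" using w(2) path_prefix unfolding xs by blast
    moreover have "length (ys @ [v]) \<le> Suc (Suc k)" using w(3) xs by simp
    ultimately show ?thesis by blast
  next
    case False
    from path_snoc[OF w(2,1) this] show ?thesis using w(3) by force
  qed
qed

text \<open>An end \<open>e\<close> of a path that is within two hops of a hidden vertex is not a leaf, so the path goes
  on, and the next vertex, being within three hops of the hidden one, is not hidden. Hence the end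
  can be pushed to distance three from \<open>d\<close>, or to distance two if \<open>e\<close> is adjacent to \<open>d\<close>.
  The first claim keeps a condition on all such neighbours of \<open>e\<close> from holding vacuously.\<close>

lemma extend_beyond:
  assumes apart: "\<forall>d\<in>H. \<forall>d'\<in>H. \<forall>xs. d \<noteq> d' \<longrightarrow> path d xs d' \<longrightarrow> 5 \<le> length xs"
    and nonleaf: "\<forall>d\<in>H. \<forall>xs l a. path d xs l \<longrightarrow> length xs \<le> 3 \<longrightarrow> adj l a \<longrightarrow>
      (\<exists>b. b \<noteq> a \<and> adj l b)"
    and d: "d \<in> H" and p: "path u (A @ d # B) e" and B: "B \<noteq> []" and e: "e \<notin> H"
  shows "\<exists>f. f \<notin> H \<and> adj e f"
    and "\<exists>r e'. path u (A @ d # B @ r) e' \<and> (e' = e \<or> e' \<notin> H \<and> adj e e') \<and>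
      (3 \<le> length (B @ r) \<or> length B = 1 \<and> length (B @ r) = 2)"
proof -
  have lastB: "last B = e" using p B unfolding vertex_path_def by simp
  \<comment> \<open>Here \<open>g\<close> is any hidden vertex one or two hops before the end; it need not be \<open>d\<close>.\<close>
  have step: "\<exists>f. f \<notin> H \<and> adj e f \<and> path u (xs @ [a, e, f]) f"
    if q: "path u (xs @ [a, e]) e" and g: "g \<in> H" "path g (ys @ [a, e]) e" "length ys \<le> 1" for xs a g ys
  proof -
    have "adj e a" using q adj_sym unfolding vertex_path_def by (simp add: successively_append_iff)
    then obtain f where f: "f \<noteq> a" "adj e f"
      using nonleaf g by force
    have pf: "path g (ys @ [a, e, f]) f" by (rule path_extend[OF g(2) f(2,1)])
    have "f \<noteq> g" using pf f(1) unfolding vertex_path_def by (cases ys) auto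
    hence "f \<notin> H" using apart g(1,3) pf by force
    thus ?thesis using f path_extend[OF q f(2,1)] by blast
  qed
  consider (one) "B = [e]" | (two) a where "B = [a, e]" | (more) "3 \<le> length B"
    using lastB B by (cases B; cases "tl B"; cases "tl (tl B)") (auto simp: Suc_le_eq)
  note cases = this
  have pd: "path d (d # B) e" using path_suffix[OF p] .
  show "\<exists>r e'. path u (A @ d # B @ r) e' \<and> (e' = e \<or> e' \<notin> H \<and> adj e e') \<and>
      (3 \<le> length (B @ r) \<or> length B = 1 \<and> length (B @ r) = 2)"
  proof (cases rule: cases)
    case one
    obtain f where "f \<notin> H" "adj e f" "path u (A @ [d, e, f]) f"
      using step[of A d d "[]"] p pd d unfolding one by auto
    thus ?thesis unfolding one by (intro exI[of _ "[f]"] exI[of _ f]) simp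
  next
    case two
    obtain f where "f \<notin> H" "adj e f" "path u (A @ [d, a, e, f]) f"
      using step[of "A @ [d]" a d "[d]"] p pd d unfolding two by auto
    thus ?thesis unfolding two by (intro exI[of _ "[f]"] exI[of _ f]) simp
  next
    case more
    thus ?thesis using p by (intro exI[of _ "[]"] exI[of _ e]) simp
  qed
  obtain C where C: "B = C @ [e]" using lastB B by (metis append_butlast_last_id)
  obtain xs a where "d # C = xs @ [a]" by (metis append_butlast_last_id list.distinct(1))
  hence xa: "d # B = xs @ [a, e]" unfolding C by (metis append_Cons append_assoc append_Nil)
  show "\<exists>f. f \<notin> H \<and> adj e f"
  proof (cases "a \<in> H")
    case False
    have "adj a e" using pd unfolding xa vertex_path_def by (simp add: successively_append_iff)
    thus ?thesis using False adj_sym by blast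
  next
    case True
    have q: "path u ((A @ xs) @ [a, e]) e" using p xa by simp
    have g: "path a ([] @ [a, e]) e" using path_suffix[of u "A @ xs" a "[e]" e] p xa by simp
    from step[OF q True g] show ?thesis by auto
  qed
qed

text \<open>The path through \<open>d\<close> is prolonged at both ends. Unless it was \<open>c - d - e\<close>, the result has at least
  six vertices; by uniqueness of paths this contradicts the bound on the distance between
  \<open>c\<close> or \<open>b\<close> and \<open>e\<close> or \<open>f\<close>.\<close>

lemma common_hidden_neighbour:
  assumes apart: "\<forall>d\<in>H. \<forall>d'\<in>H. \<forall>xs. d \<noteq> d' \<longrightarrow> path d xs d' \<longrightarrow> 5 \<le> length xs"
    and nonleaf: "\<forall>d\<in>H. \<forall>xs l a. path d xs l \<longrightarrow> length xs \<le> 3 \<longrightarrow> adj l a \<longrightarrow>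
      (\<exists>b. b \<noteq> a \<and> adj l b)"
    and p: "path c P e" and d: "d \<in> H" "d \<in> set P" and ce: "c \<notin> H" "e \<notin> H"
    and close: "\<And>b f u v. b \<notin> H \<Longrightarrow> f \<notin> H \<Longrightarrow> adj c b \<Longrightarrow> adj e f \<Longrightarrow> u \<in> {b, c} \<Longrightarrow> v \<in> {e, f} \<Longrightarrow>
      \<exists>xs. path u xs v \<and> length xs \<le> 5"
  shows "adj c d \<and> adj d e"
proof (rule ccontr)
  assume contr: "\<not> (adj c d \<and> adj d e)"
  obtain A B where P: "P = A @ d # B" using d(2) by (meson split_list)
  have A: "A \<noteq> []" using p ce(1) d(1) unfolding P vertex_path_def by (cases A) auto
  have B: "B \<noteq> []" using p ce(2) d(1) unfolding P vertex_path_def by (cases B) auto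
  note p' = p[unfolded P]
  obtain f where f: "f \<notin> H" "adj e f"
    using extend_beyond(1)[OF apart nonleaf d(1) p' B ce(2)] by blast
  obtain r e' where r: "path c (A @ d # B @ r) e'" "e' = e \<or> e' \<notin> H \<and> adj e e'"
      "3 \<le> length (B @ r) \<or> length B = 1 \<and> length (B @ r) = 2"
    using extend_beyond(2)[OF apart nonleaf d(1) p' B ce(2)] by blast
  have q: "path e' (rev (B @ r) @ d # rev A) c" using path_rev[OF r(1)] by simp
  have rA: "rev A \<noteq> []" using A by simp
  obtain b where b: "b \<notin> H" "adj c b"
    using extend_beyond(1)[OF apart nonleaf d(1) q rA ce(1)] by blast
  obtain s c' where s: "path e' (rev (B @ r) @ d # rev A @ s) c'" "c' = c \<or> c' \<notin> H \<and> adj c c'"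
      "3 \<le> length (rev A @ s) \<or> length (rev A) = 1 \<and> length (rev A @ s) = 2"
    using extend_beyond(2)[OF apart nonleaf d(1) q rA ce(1)] by blast
  have "\<not> (length A = 1 \<and> length B = 1)"
  proof
    assume "length A = 1 \<and> length B = 1"
    then obtain a1 b1 where ab: "A = [a1]" "B = [b1]" by (auto simp: length_Suc_conv)
    have "a1 = c" "b1 = e" using p' unfolding ab vertex_path_def by auto
    thus False using p' contr unfolding ab vertex_path_def by auto
  qed
  hence long: "6 \<le> length (rev (B @ r) @ d # rev A @ s)" using r(3) s(3) by auto
  have "\<exists>xs. path c' xs e' \<and> length xs \<le> 5"
    using r(2) s(2) close[of b f c' e'] close[of c' f c' e'] close[of b e' c' e'] close[of c' e' c' e'] b f
    by auto
  then obtain xs where xs: "path c' xs e'" "length xs \<le> 5" by blast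
  have "rev xs = rev (B @ r) @ d # rev A @ s" by (rule unique[OF path_rev[OF xs(1)] s(1)])
  hence "length (rev xs) = length (rev (B @ r) @ d # rev A @ s)" by simp
  thus False using long xs(2) by simp
qed

end

context pair_wf_digraph
begin

abbreviation is_path :: "'a \<Rightarrow> 'a list \<Rightarrow> 'a \<Rightarrow> bool" where
  "is_path \<equiv> vertex_path (pverts G) (\<lambda>u v. (u, v) \<in> parcs G)"

lemma apath_of_vertex_path:
  assumes "is_path u xs v"
  shows "apath u (zip xs (tl xs)) v \<and> awalk_verts u (zip xs (tl xs)) = xs"
  using assms
proof (induction xs arbitrary: u rule: induct_list012)
  case (2 x)
  thus ?case by (auto simp: apath_Nil_iff vertex_path_def)
next
  case (3 x y zs)
  hence "is_path y (y # zs) v" by (simp add: vertex_path_def)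
  hence IH: "apath y (zip (y # zs) zs) v" "awalk_verts y (zip (y # zs) zs) = y # zs"
    using 3(2)[of y] by auto
  show ?case using IH 3(3) by (auto simp: apath_Cons_iff vertex_path_def)
qed (simp add: vertex_path_def)

lemma vertex_path_of_apath:
  assumes "apath u p v"
  shows "is_path u (awalk_verts u p) v"
proof -
  have w: "awalk u p v" and dist: "distinct (awalk_verts u p)"
    using assms unfolding apath_def by auto
  have "successively (\<lambda>u v. (u, v) \<in> parcs G) (awalk_verts u p)"
    using w
  proof (induction p arbitrary: u)
    case (Cons a p)
    hence a: "a \<in> parcs G" "awalk (snd a) p v" by (simp_all add: awalk_Cons_iff)
    have "hd (awalk_verts (snd a) p) = snd a" using a(2) unfolding awalk_conv by simp
    thus ?case using Cons.IH[OF a(2)] a(1) by (simp add: successively_Cons)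
  qed simp
  moreover have "set (awalk_verts u p) \<subseteq> verts G \<and> awhd u p = u \<and> awlast u p = v"
    using w unfolding awalk_conv by simp
  moreover have "awalk_verts u p \<noteq> []" by (rule awalk_verts_non_Nil)
  ultimately show ?thesis using dist unfolding vertex_path_def by simp
qed

lemma hop_distance_le_vertex_path:
  assumes "is_path u xs v"
  shows "hop_distance G u v \<le> ereal (real (length xs - 1))"
proof -
  have "awalk u (zip xs (tl xs)) v"
    using apath_of_vertex_path[OF assms] unfolding apath_def by blast
  from min_cost_le_walk_cost[OF this, of "\<lambda>_. 1"]
  show ?thesis by (simp add: awalk_cost_def sum_list_triv)
qed

text \<open>A pair digraph has no parallel arcs, so a path of arcs is determined by its list of vertices, and
  uniqueness passes from one kind of path to the other.\<close>

lemma undirected_tree_path_tree: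
  assumes tree: "undirected_tree G" and sym: "sym (parcs G)" and irrefl: "irrefl (parcs G)"
  shows "path_tree (pverts G) (\<lambda>u v. (u, v) \<in> parcs G)"
proof
  have ex1: "\<exists>!p. apath u p v" if "u \<in> pverts G" "v \<in> pverts G" for u v
    using tree that unfolding undirected_tree_def by simp
  show "(u, v) \<in> parcs G \<Longrightarrow> v \<in> pverts G" for u v by (rule in_arcsD2)
  show "(u, v) \<in> parcs G \<Longrightarrow> (v, u) \<in> parcs G" for u v using sym by (rule symD)
  show "(u, u) \<notin> parcs G" for u using irrefl by (auto simp: irrefl_def)
  show "\<exists>xs. is_path u xs v" if "u \<in> pverts G" "v \<in> pverts G" for u v
    using ex1[OF that] vertex_path_of_apath by blast
  show "xs = ys" if xs: "is_path u xs v" and ys: "is_path u ys v" for u v xs ys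
  proof -
    have "u \<in> pverts G" "v \<in> pverts G" using xs unfolding vertex_path_def by auto
    from ex1[OF this] have "zip xs (tl xs) = zip ys (tl ys)"
      using apath_of_vertex_path[OF xs] apath_of_vertex_path[OF ys] by blast
    thus "xs = ys"
      using apath_of_vertex_path[OF xs] apath_of_vertex_path[OF ys] by metis
  qed
qed

end

section \<open>The common hidden neighbour\<close>

lemma reachable_along_path:
  fixes G :: "('v, 'e) pre_digraph"
  assumes "wf_digraph G" "xs \<noteq> []" "set xs \<subseteq> verts G" "successively (\<lambda>u v. u \<rightarrow>\<^bsub>G\<^esub> v) xs"
  shows "hd xs \<rightarrow>\<^sup>*\<^bsub>G\<^esub> last xs"
proof -
  interpret wf_digraph G by fact
  show ?thesis using assms(2-)
  proof (induction xs rule: induct_list012)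
    case (3 x y zs)
    hence "y \<rightarrow>\<^sup>*\<^bsub>G\<^esub> last (y # zs)" "x \<rightarrow>\<^bsub>G\<^esub> y" by auto
    thus ?case by (simp add: adj_reachable_trans)
  qed auto
qed

theorem theorem14:
  fixes M :: "'a measure"
    and n m T :: nat
    and per :: "nat \<Rightarrow> nat"
    and h :: "nat \<Rightarrow> nat \<Rightarrow> int \<Rightarrow> complex"
    and x \<epsilon> :: "nat \<Rightarrow> int \<Rightarrow> 'a \<Rightarrow> complex"
    and V\<^sub>o V\<^sub>h :: "nat set"
    and G G\<^sub>o G\<^sub>c :: "(nat, nat \<times> nat) pre_digraph"
    and T1 T2 :: "nat set"
    and c e :: nat
  assumes system: "nlds M n per h x \<epsilon>"
    and nodes: "m \<le> n" "V\<^sub>o = {..<m}" "V\<^sub>h = {m..<n}"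
    and period: "T = Lcm (per ` V\<^sub>o)"
    and hidden_periods: "\<forall>i\<in>V\<^sub>h. per i dvd T"
    and well_posed: "well_posed_detectable M n T h \<epsilon>"
    and bidirected: "\<forall>i<n. \<forall>j<n. nonzero_block T (transfer_matrix n T h) j i \<longrightarrow>
                       nonzero_block T (transfer_matrix n T h) i j"
    and G: "G = network_topology n T h"
    and hidden_apart: "\<forall>d\<in>V\<^sub>h. \<forall>d'\<in>V\<^sub>h. d \<noteq> d' \<longrightarrow> 4 \<le> hop_distance G d d'"
    and tree: "undirected_tree G"
    and hidden_leaf: "\<forall>d\<in>V\<^sub>h. \<forall>l. leaf G l \<longrightarrow> 3 \<le> hop_distance G d l"
    and G\<^sub>o: "G\<^sub>o = G \<restriction> V\<^sub>o"
    and G\<^sub>c: "G\<^sub>c = inverse_psd_graph M n m T x"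
    and components: "T1 \<in> pre_digraph.sccs_verts G\<^sub>o" "T2 \<in> pre_digraph.sccs_verts G\<^sub>o" "T1 \<noteq> T2"
    and members: "c \<in> T1" "e \<in> T2"
    and cliques: "\<forall>b\<in>T1. \<forall>f\<in>T2. b \<rightarrow>\<^bsub>G\<^sub>o\<^esub> c \<and> e \<rightarrow>\<^bsub>G\<^sub>o\<^esub> f \<longrightarrow> clique G\<^sub>c {b, c, e, f}"
  shows "\<exists>d\<in>V\<^sub>h. pre_digraph.apath G c [(c, d), (d, e)] e"
proof -
  define E where "E = {(i, j). (i, j) \<in> generative_edges n T h \<or> (j, i) \<in> generative_edges n T h}"
  define adj where "adj u v \<longleftrightarrow> (u, v) \<in> E" for u v
  define PG where "PG = \<lparr>pverts = {..<n}, parcs = E\<rparr>"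
  have G_eq: "G = with_proj PG" by (simp add: G network_topology_def PG_def E_def)
  interpret pair_wf_digraph PG
    by standard (auto simp: PG_def E_def generative_edges_def)
  have symE: "sym E" by (auto simp: sym_def E_def)
  have "\<not> nonzero_block T (transfer_matrix n T h) i i" if "i < n" for i
    using transfer_block_diagonal[OF that] by (simp add: nonzero_block_def)
  hence irreflE: "irrefl E" by (auto simp: irrefl_def E_def generative_edges_def)
  have "path_tree (pverts PG) (\<lambda>u v. (u, v) \<in> parcs PG)"
    by (rule undirected_tree_path_tree)
      (use tree symE irreflE in \<open>simp_all add: G_eq PG_def\<close>)
  hence "path_tree {..<n} adj" by (simp add: PG_def adj_def[abs_def])
  then interpret tree: path_tree "{..<n}" adj .
  have is_path: "is_path u xs v = tree.path u xs v" for u xs v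
    by (simp add: PG_def adj_def[abs_def])
  note hop = hop_distance_le_vertex_path[unfolded is_path, folded G_eq]
  have adj_n: "u < n" "v < n" if "adj u v" for u v
    using that by (auto simp: adj_def E_def generative_edges_def)
  have apart: "\<forall>d\<in>V\<^sub>h. \<forall>d'\<in>V\<^sub>h. \<forall>xs. d \<noteq> d' \<longrightarrow> tree.path d xs d' \<longrightarrow> 5 \<le> length xs"
  proof (intro ballI allI impI)
    fix d d' xs assume d: "d \<in> V\<^sub>h" "d' \<in> V\<^sub>h" "d \<noteq> d'" and p: "tree.path d xs d'"
    have "ereal 4 \<le> ereal (real (length xs - 1))"
      using hidden_apart d hop[OF p] order_trans[of "4::ereal"] by fastforce
    thus "5 \<le> length xs" by simp
  qed
  have nonleaf: "\<forall>d\<in>V\<^sub>h. \<forall>xs l a. tree.path d xs l \<longrightarrow> length xs \<le> 3 \<longrightarrow> adj l a \<longrightarrow>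
      (\<exists>b. b \<noteq> a \<and> adj l b)"
  proof (intro ballI allI impI, rule ccontr)
    fix d xs l a
    assume d: "d \<in> V\<^sub>h" and p: "tree.path d xs l" "length xs \<le> 3" and a: "adj l a"
      and "\<nexists>b. b \<noteq> a \<and> adj l b"
    hence "out_arcs G l = {(l, a)}"
      by (auto simp: out_arcs_def G_eq PG_def adj_def)
    hence "leaf G l" using adj_n[OF a] by (simp add: leaf_def out_degree_def G_eq PG_def)
    hence "3 \<le> hop_distance G d l" using hidden_leaf d by blast
    also have "\<dots> \<le> ereal (real (length xs - 1))" by (rule hop[OF p(1)])
    finally have "ereal 3 \<le> ereal (real (length xs - 1))" by simp
    thus False using p(2) by simp
  qed
  have linked_path: "\<exists>xs. tree.path i xs j \<and> length xs \<le> 3" if l: "linked n adj i j" "i < n" for i j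
  proof -
    obtain k where "k \<le> 2" "(adj ^^ k) i j" using linked_imp_walk[OF tree.adj_sym l(1)] by blast
    thus ?thesis using tree.path_of_walk[of k i j] l(2) by force
  qed
  have Gc_close: "\<exists>xs. tree.path u xs v \<and> length xs \<le> 5" if "u \<rightarrow>\<^bsub>G\<^sub>c\<^esub> v" for u v
  proof -
    have uv: "u < m" "v < m" "nonzero_block T (\<lambda>\<omega>. inv_mat (observed_psd M n m T x \<omega>)) u v"
      using that by (auto simp: G\<^sub>c inverse_psd_graph_def)
    have "per i dvd T" if "i < n" for i
      using that hidden_periods period nodes by (cases "i < m") auto
    moreover have "Lcm (per ` V\<^sub>o) dvd Lcm (per ` {..<n})"
      using nodes by (intro Lcm_least dvd_Lcm) auto
    \<comment> \<open>The hidden periods divide the period of the observed part, so the common period of all nodes is that of the observed ones.\<close>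
    ultimately have T: "T = Lcm (per ` {..<n})"
      using period by (intro dvd_antisym) (auto intro!: Lcm_least)
    have "linked n adj u v \<or> (\<exists>d. m \<le> d \<and> d < n \<and> linked n adj u d \<and> linked n adj d v)"
    proof (rule inverse_psd_graph_edge[OF system T nodes(1) well_posed _ _ uv])
      show "adj i j" if "i < n" "j < n" "nonzero_block T (transfer_matrix n T h) i j" for i j
        using that by (simp add: adj_def E_def generative_edges_def)
      show "i = j" if ij: "m \<le> i" "i < n" "m \<le> j" "j < n" "linked n adj i j" for i j
      proof (rule ccontr)
        assume "i \<noteq> j"
        obtain xs where xs: "tree.path i xs j" "length xs \<le> 3"
          using linked_path[OF ij(5,2)] by blast
        have "i \<in> V\<^sub>h" "j \<in> V\<^sub>h" using ij nodes by auto
        hence "5 \<le> length xs" using apart \<open>i \<noteq> j\<close> xs(1) by blast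
        thus False using xs(2) by simp
      qed
    qed
    hence "\<exists>k\<le>4. (adj ^^ k) u v"
    proof
      assume "linked n adj u v"
      then obtain k where "k \<le> 2" "(adj ^^ k) u v" using linked_imp_walk[of adj, OF tree.adj_sym] by blast
      thus ?thesis by (intro exI[of _ k]) simp
    next
      assume "\<exists>d. m \<le> d \<and> d < n \<and> linked n adj u d \<and> linked n adj d v"
      then obtain d where "linked n adj u d" "linked n adj d v" by blast
      then obtain k l where "k \<le> 2" "(adj ^^ k) u d" "l \<le> 2" "(adj ^^ l) d v"
        using linked_imp_walk[of adj, OF tree.adj_sym] by meson
      hence "(adj ^^ (k + l)) u v" "k + l \<le> 4" by (auto simp only: relpowp_add relcompp.intros)
      thus ?thesis by blast
    qed
    then obtain k where "k \<le> 4" "(adj ^^ k) u v" by blast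
    thus ?thesis using tree.path_of_walk[of k u v] uv(1) nodes(1) by force
  qed
  have wfo: "wf_digraph G\<^sub>o"
    unfolding G\<^sub>o by standard (auto simp: induce_subgraph_def)
  interpret o: wf_digraph G\<^sub>o by (rule wfo)
  have dom: "u \<rightarrow>\<^bsub>G\<^sub>o\<^esub> v \<longleftrightarrow> adj u v \<and> u < m \<and> v < m" for u v
    by (auto simp: G\<^sub>o G_eq PG_def adj_def nodes induce_subgraph_def arcs_ends_def arc_to_ends_def image_iff)
  have T_verts: "T1 \<subseteq> {..<m}" "T2 \<subseteq> {..<m}"
    using o.sccs_verts_subsets components by (auto simp: G\<^sub>o nodes)
  have closed: "v \<in> S" if S: "S \<in> o.sccs_verts" "u \<in> S" and uv: "u \<rightarrow>\<^sup>*\<^bsub>G\<^sub>o\<^esub> v" "v \<rightarrow>\<^sup>*\<^bsub>G\<^sub>o\<^esub> u" for S u v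
    using S uv unfolding o.in_sccs_verts_conv_reachable by blast
  have closed_adj: "v \<in> S" if S: "S \<in> o.sccs_verts" "u \<in> S" and "adj u v" "v < m" for S u v
  proof (rule closed[OF S])
    have "u < m" using o.sccs_verts_subsets[OF S(1)] S(2) by (auto simp: G\<^sub>o nodes)
    hence "u \<rightarrow>\<^bsub>G\<^sub>o\<^esub> v" "v \<rightarrow>\<^bsub>G\<^sub>o\<^esub> u" using that tree.adj_sym by (auto simp: dom)
    thus "u \<rightarrow>\<^sup>*\<^bsub>G\<^sub>o\<^esub> v" "v \<rightarrow>\<^sup>*\<^bsub>G\<^sub>o\<^esub> u" by auto
  qed
  have ce: "c < m" "e < m" using members T_verts by auto
  obtain P where P: "tree.path c P e" using tree.connected[of c e] ce nodes(1) by auto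
  have "\<exists>d\<in>V\<^sub>h. d \<in> set P"
  proof (rule ccontr)
    assume none: "\<not> ?thesis"
    have "set P \<subseteq> {..<n}" using P by (simp add: vertex_path_def)
    hence obs: "set P \<subseteq> {..<m}"
      using none unfolding nodes by (metis atLeastLessThan_iff lessThan_iff not_le subset_iff)
    have reach: "u \<rightarrow>\<^sup>*\<^bsub>G\<^sub>o\<^esub> v" if "tree.path u Q v" "set Q \<subseteq> {..<m}" for u Q v
    proof -
      have Q: "Q \<noteq> []" "hd Q = u" "last Q = v" "successively adj Q" using that(1) by (auto simp: vertex_path_def)
      have "successively (\<lambda>u v. u \<rightarrow>\<^bsub>G\<^sub>o\<^esub> v) Q"
        by (rule successively_mono[OF Q(4)]) (use that(2) in \<open>auto simp: dom\<close>)
      from reachable_along_path[OF wfo Q(1) _ this] show ?thesis using Q that(2) by (simp add: G\<^sub>o nodes)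
    qed
    have "e \<in> T1"
      using closed[OF components(1) members(1)] reach[OF P obs] reach[OF tree.path_rev[OF P]] obs by simp
    thus False using o.sccs_verts_disjoint[OF components] members by blast
  qed
  then obtain d where d: "d \<in> V\<^sub>h" "d \<in> set P" by blast
  have "adj c d \<and> adj d e"
  proof (rule tree.common_hidden_neighbour[OF apart nonleaf P d])
    show "c \<notin> V\<^sub>h" "e \<notin> V\<^sub>h" using ce nodes by auto
    fix b f u v
    assume b: "b \<notin> V\<^sub>h" "adj c b" and f: "f \<notin> V\<^sub>h" "adj e f" and uv: "u \<in> {b, c}" "v \<in> {e, f}"
    have bf: "b < m" "f < m" using b f adj_n nodes by force+
    have bT: "b \<in> T1" and fT: "f \<in> T2"
      using closed_adj[OF components(1) members(1) b(2) bf(1)]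
        closed_adj[OF components(2) members(2) f(2) bf(2)] .
    have "b \<rightarrow>\<^bsub>G\<^sub>o\<^esub> c" "e \<rightarrow>\<^bsub>G\<^sub>o\<^esub> f" using b f bf ce tree.adj_sym by (auto simp: dom)
    hence clique: "clique G\<^sub>c {b, c, e, f}" using cliques bT fT by blast
    have "u \<in> T1" "v \<in> T2" using uv bT fT members by auto
    hence "u \<noteq> v" using o.sccs_verts_disjoint[OF components] by blast
    hence "u \<rightarrow>\<^bsub>G\<^sub>c\<^esub> v" using clique uv unfolding clique_def by blast
    thus "\<exists>xs. tree.path u xs v \<and> length xs \<le> 5" by (rule Gc_close)
  qed
  moreover have "c \<noteq> e" using members o.sccs_verts_disjoint[OF components] by blast
  ultimately have "is_path c [c, d, e] e"
    unfolding is_path using adj_n tree.adj_irrefl by (auto simp: vertex_path_def)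
  from apath_of_vertex_path[OF this] have "apath c [(c, d), (d, e)] e" by simp
  thus ?thesis using d(1) unfolding G_eq by blast
qed

end
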